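(* Let $N\ge 1$ be an integer, let $\vec X = (X_1,\dots,X_N)$ be a vector chosen uniformly at random from the unit Euclidean sphere $S^{N-1}\subset\mathbb R^N$, and let $\Phi$ be the standard Gaussian CDF. Then for all $\epsilon>0$ and all $t\in[0,1)$, $$\Pr\left(d_{\mathrm{KS}}\left(\widehat F_{\sqrt N\vec X},\Phi\right) > \epsilon+\frac t2\right)\le 2e^{-2N\epsilon^2}+e^{-\frac{9}{64}Nt^2}+e^{-Nt^2}.$$
   Context: The empirical CDF of a random vector $\vec V=(V_1,\dots,V_N)$ with real-valued (not necessarily independent) components is $\widehat F_{\vec V}(x)=\frac1N\sum_{i=1}^N \mathbf 1_{\{V_i\le x\}}$, $x\in\mathbb R$. The Kolmogorov-Smirnov distance between CDFs $F$ and $G$ is $d_{\mathrm{KS}}(F,G)=\sup_{x\in\mathbb R}|F(x)-G(x)|$. Here $\sqrt N\vec X=(\sqrt N X_1,\dots,\sqrt N X_N)$. *)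

theory Defs
  imports "HOL-Probability.Probability"
begin

text \<open>
  The uniform distribution on the unit sphere, defined through the cone construction of the
  normalised surface measure: a Borel set \<open>A\<close> of the sphere gets the mass
  \<open>vol {r a | 0 < r \<le> 1, a \<in> A} / vol (unit ball)\<close>, i.e. it is the law of \<open>x / norm x\<close>
  for \<open>x\<close> uniform on the unit ball (the value \<open>sgn 0 = 0\<close> has probability zero). It lives on
  the Borel sets of the ambient space.
\<close>

definition uniform_sphere :: "'a::euclidean_space measure" where
  "uniform_sphere = distr (uniform_measure lborel (cball 0 1)) borel sgn"

lemma sgn_borel_measurable [measurable]:
  "(sgn :: 'a::euclidean_space \<Rightarrow> 'a) \<in> borel_measurable borel"
  unfolding sgn_div_norm[abs_def] by measurable

lemma sets_uniform_sphere [simp, measurable_cong]: "sets uniform_sphere = sets borel"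
  by (simp add: uniform_sphere_def)

lemma emeasure_unit_cball:
  "emeasure lborel (cball 0 1 :: 'a::euclidean_space set) \<noteq> 0"
  "emeasure lborel (cball 0 1 :: 'a::euclidean_space set) \<noteq> \<infinity>"
  by (simp_all add: emeasure_cball unit_ball_vol_pos less_imp_neq[symmetric] ennreal_eq_0_iff not_le)

lemma prob_space_uniform_sphere: "prob_space (uniform_sphere :: 'a::euclidean_space measure)"
  unfolding uniform_sphere_def
  by (intro prob_space.prob_space_distr prob_space_uniform_measure emeasure_unit_cball) simp

lemma AE_uniform_sphere: "AE x in uniform_sphere :: 'a::euclidean_space measure. x \<in> sphere 0 1"
proof -
  have "AE x in lborel :: 'a measure. x \<noteq> 0"
    by (rule AE_lborel_singleton)
  then have "AE x in uniform_measure lborel (cball 0 1 :: 'a set). norm (sgn x) = 1"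
    by (intro AE_uniform_measureI) (auto simp: norm_sgn)
  then show ?thesis
    unfolding uniform_sphere_def by (subst AE_distr_iff) simp_all
qed

lemma distr_lborel_orthogonal:
  fixes T :: "'a::euclidean_space \<Rightarrow> 'a"
  assumes T: "orthogonal_transformation T"
  shows "distr lborel borel T = lborel"
proof -
  have bij: "bij T" and invT: "orthogonal_transformation (inv T)"
    using T by (simp_all add: orthogonal_transformation_bij orthogonal_transformation_inv)
  have [measurable]: "T \<in> borel_measurable borel"
    using T by (intro borel_measurable_continuous_onI linear_continuous_on)
       (simp add: linear_conv_bounded_linear[symmetric] orthogonal_transformation_linear)
  have vim: "T -` A = inv T ` A" for A
    using bij by (simp add: bij_vimage_eq_inv_image)
  have vim_ball: "T -` ball a r = ball (inv T a) r" for a r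
  proof -
    have "dist (inv T a) x = dist a (T x)" for x
    proof -
      have "dist a (T x) = dist (T (inv T a)) (T x)"
        using bij by (simp add: bij_is_surj surj_f_inv_f)
      also have "\<dots> = dist (inv T a) x"
        using T by (metis orthogonal_transformation_isometry)
      finally show ?thesis ..
    qed
    then show ?thesis by auto
  qed
  have eq_open: "emeasure (distr lborel borel T) S = emeasure lborel S" if "open S" for S
  proof -
    define K where "K = {p :: 'a \<times> real. ball (fst p) (snd p) \<subseteq> S}"
    have fine: "\<exists>i. i \<in> K \<and> x \<in> ball (fst i) (snd i) \<and> snd i < d" if "x \<in> S" "0 < d" for x d
    proof -
      obtain e where e: "e > 0" "ball x e \<subseteq> S"
        using \<open>open S\<close> \<open>x \<in> S\<close> openE by blast
      have "ball x (min e (d / 2)) \<subseteq> ball x e" by (rule subset_ball) simp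
      with e that show ?thesis
        by (intro exI[of _ "(x, min e (d / 2))"]) (auto simp: K_def)
    qed
    from fine obtain C where C: "countable C" "C \<subseteq> K"
      and disj: "pairwise (\<lambda>i j. disjnt (ball (fst i) (snd i)) (ball (fst j) (snd j))) C"
      and neg: "negligible (S - (\<Union>i\<in>C. ball (fst i) (snd i)))"
      using Vitali_covering_theorem_balls[of S K fst snd] by blast
    define U where "U = (\<Union>i\<in>C. ball (fst i) (snd i))"
    have [measurable]: "U \<in> sets borel" "S \<in> sets borel"
      using \<open>open S\<close> by (auto simp: U_def intro!: borel_open)
    have "U \<subseteq> S" using C by (auto simp: U_def K_def)
    have null: "S - U \<in> null_sets lborel"
      using neg by (simp add: U_def[symmetric] negligible_iff_null_sets null_sets_completion_iff)
    have "negligible (inv T ` (S - U))"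
      using neg invT unfolding U_def[symmetric]
      by (intro negligible_differentiable_image_negligible order_refl
            linear_imp_differentiable_on orthogonal_transformation_linear)
    then have "T -` (S - U) \<in> null_sets lebesgue"
      by (simp only: vim negligible_iff_null_sets)
    moreover have "T -` (S - U) \<in> sets borel"
      by (rule measurable_sets_borel[where M=borel]) measurable
    ultimately have "T -` (S - U) \<in> null_sets lborel"
      by (simp add: null_sets_completion_iff)
    then have null': "S - U \<in> null_sets (distr lborel borel T)"
      by (simp add: null_sets_def emeasure_distr)
    have df: "disjoint_family_on (\<lambda>i. ball (fst i) (snd i)) C"
      using disj by (auto simp: disjoint_family_on_def pairwise_def disjnt_def)
    have *: "emeasure M S = (\<integral>\<^sup>+i. emeasure M (ball (fst i) (snd i)) \<partial>count_space C)"
      if M: "sets M = sets borel" and n: "S - U \<in> null_sets M" for M :: "'a measure"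
    proof -
      have "emeasure M S = emeasure M (U \<union> (S - U))"
        using \<open>U \<subseteq> S\<close> by (simp add: Un_absorb1)
      also have "\<dots> = emeasure M U"
        using n by (intro emeasure_Un_null_set) (simp_all add: M)
      also have "\<dots> = (\<integral>\<^sup>+i. emeasure M (ball (fst i) (snd i)) \<partial>count_space C)"
        unfolding U_def using C df by (intro emeasure_UN_countable) (auto simp: M)
      finally show ?thesis .
    qed
    have "emeasure (distr lborel borel T) (ball a r) = emeasure lborel (ball a r)" for a r
    proof (cases "r \<ge> 0")
      case True
      then show ?thesis by (simp add: emeasure_distr vim_ball emeasure_ball)
    next
      case False
      then have "ball a r = {}" by simp
      then show ?thesis by (simp only: emeasure_empty)
    qed
    then show ?thesis
      by (simp add: *[OF _ null] *[OF _ null'])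
  qed
  have "lborel = distr lborel borel T"
    by (rule lborel_eqI) (simp_all add: eq_open open_box)
  then show ?thesis ..
qed

text \<open>
  Together with \<open>AE_uniform_sphere\<close>, this rotation invariance characterises the uniform
  probability distribution on the sphere.
\<close>

lemma distr_uniform_sphere_orthogonal:
  fixes T :: "'a::euclidean_space \<Rightarrow> 'a"
  assumes T: "orthogonal_transformation T"
  shows "distr uniform_sphere borel T = uniform_sphere"
proof -
  have [measurable]: "T \<in> borel_measurable borel"
    using T by (intro borel_measurable_continuous_onI linear_continuous_on)
       (simp add: linear_conv_bounded_linear[symmetric] orthogonal_transformation_linear)
  have norm_T: "norm (T x) = norm x" for x
    using T by (simp add: orthogonal_transformation_norm)
  have sgn_T: "sgn (T x) = T (sgn x)" for x
    using T by (simp add: sgn_div_norm norm_T orthogonal_transformation_linear linear_scale)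
  have ball: "T -` A \<inter> cball 0 1 = T -` (A \<inter> cball 0 1)" for A
    by (auto simp: norm_T)
  have "distr (uniform_measure lborel (cball 0 1)) borel T = uniform_measure lborel (cball 0 1)"
  proof (rule measure_eqI)
    fix A :: "'a set" assume "A \<in> sets (distr (uniform_measure lborel (cball 0 1)) borel T)"
    then have [measurable]: "A \<in> sets borel" by simp
    have "emeasure lborel (T -` A \<inter> cball 0 1) = emeasure (distr lborel borel T) (A \<inter> cball 0 1)"
      by (simp add: emeasure_distr ball)
    moreover have "T -` A \<in> sets borel"
      by (rule measurable_sets_borel[where M=borel]) measurable
    ultimately show "emeasure (distr (uniform_measure lborel (cball 0 1)) borel T) A =
        emeasure (uniform_measure lborel (cball 0 1)) A"
      by (simp add: emeasure_distr distr_lborel_orthogonal[OF T] Int_commute)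
  qed simp
  then have "uniform_sphere = distr (distr (uniform_measure lborel (cball 0 1)) borel T) borel sgn"
    by (simp add: uniform_sphere_def)
  also have "\<dots> = distr uniform_sphere borel T"
    by (simp add: uniform_sphere_def distr_distr o_def sgn_T)
  finally show ?thesis ..
qed

definition empirical_cdf :: "real ^ 'n \<Rightarrow> real \<Rightarrow> real" where
  "empirical_cdf v x = (1 / real CARD('n)) * (\<Sum>i\<in>UNIV. indicator {..x} (v $ i))"

definition ks_dist :: "(real \<Rightarrow> real) \<Rightarrow> (real \<Rightarrow> real) \<Rightarrow> real" where
  "ks_dist F G = (SUP x. \<bar>F x - G x\<bar>)"

end

theory Submission
  imports Defs
begin

text \<open>
  Let \<open>z\<close> be a standard Gaussian vector, \<open>N\<close> the dimension and \<open>F\<close> the empirical distribution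
  function of \<open>z\<close>. The right-hand side of the claim is so weak that no sharp
  Dvoretzky--Kiefer--Wolfowitz inequality is needed. For
  each sign \<open>s\<close>, \<open>exp (c * (F x - \<Phi> x) / (1 - \<Phi> x))\<close> is a submartingale in \<open>x\<close>, so Doob's inequality on
  four pieces of \<open>{x. x < 0}\<close> together with Hoeffding's lemma bounds the probability of
  \<open>s * (F x - \<Phi> x) > v\<close> for some \<open>x < 0\<close> by \<open>4 * exp (- 2 * (21/25)^2 * N * v^2)\<close>. The positive
  half line is reached by replacing \<open>z\<close> with \<open>- z\<close>.

  The norm of \<open>z\<close> is independent of its direction \<open>sgn z\<close>, which is uniform on the sphere.
  If \<open>sqrt N *\<^sub>R sgn z\<close> has a deviation \<open>v\<close> at some \<open>x < 0\<close>, then \<open>z\<close> has nearly the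
  same deviation at \<open>x * norm z / sqrt N\<close>, provided \<open>norm z \<ge> sqrt (N - 1)\<close> if \<open>s = 1\<close> and
  \<open>norm z \<le> sqrt N\<close> if \<open>s = -1\<close>. Both conditions have probability at least \<open>1/2\<close>, so passing to
  the sphere costs a factor of two. With \<open>u = sqrt N * (\<epsilon> + t / 2)\<close> this gives the bound
  \<open>32 * exp (- 2 * (21/25)^2 * (u - 1/12)^2)\<close>, which is below the claimed one for \<open>u \<ge> 9/5\<close>; for
  \<open>u \<le> 9/5\<close> the claimed bound is at least \<open>1\<close>.
\<close>

section \<open>A maximal inequality for empirical distribution functions\<close>

text \<open>Hoeffding's lemma for a Bernoulli variable. For negative \<open>c\<close>, exchanging
  success and failure, that is \<open>p\<close> and \<open>1 - p\<close>, leads back to a positive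
  exponent.\<close>

lemma bernoulli_mgf_le:
  fixes p c :: real
  assumes "0 \<le> p" "p \<le> 1"
  shows "p * exp c + (1 - p) \<le> exp (c * p + c\<^sup>2 / 8)"
proof -
  have *: "q * exp h + (1 - q) \<le> exp (h * q + h\<^sup>2 / 8)" if "0 \<le> h" "0 \<le> q" for h q :: real
  proof -
    have pos: "0 < 1 + q * (exp h - 1)"
      using that by (intro add_pos_nonneg mult_nonneg_nonneg) auto
    have "ln (1 + q * (exp h - 1)) \<le> h * q + h\<^sup>2 / 8"
      using Hoeffdings_lemma_aux[OF that] by simp
    then have "1 + q * (exp h - 1) \<le> exp (h * q + h\<^sup>2 / 8)"
      using pos by (metis exp_le_cancel_iff exp_ln)
    then show ?thesis by (simp add: algebra_simps)
  qed
  show ?thesis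
  proof (cases "0 \<le> c")
    case True
    then show ?thesis using *[of c p] assms by simp
  next
    case False
    have "exp c * ((1 - p) * exp (- c) + (1 - (1 - p))) \<le> exp c * exp (- c * (1 - p) + (- c)\<^sup>2 / 8)"
      using False assms by (intro mult_left_mono *) auto
    also have "\<dots> = exp (c * p + c\<^sup>2 / 8)"
      by (simp add: exp_add[symmetric] algebra_simps)
    also have "exp c * ((1 - p) * exp (- c) + (1 - (1 - p))) = p * exp c + (1 - p)"
      by (simp add: algebra_simps flip: exp_add)
    finally show ?thesis .
  qed
qed

lemma exp_convex_combination_le:
  fixes c \<theta> :: real
  assumes "0 \<le> \<theta>" "\<theta> \<le> 1"
  shows "exp (c * \<theta>) \<le> \<theta> * exp c + (1 - \<theta>)"
proof -
  have "convex_on UNIV (exp :: real \<Rightarrow> real)"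
    using convex_on_exp[of 1] by simp
  from convex_onD[OF this, of \<theta> 0 c] assms show ?thesis
    by (simp add: algebra_simps)
qed

text \<open>Tensorisation of a one-coordinate inequality: the weights are exchanged coordinate by
  coordinate. Since \<open>\<Psi>\<close> sees the sample only through \<open>T\<close>, freezing
  the other coordinates leaves a function of \<open>T y\<close>, to which the hypothesis on
  \<open>b\<close> and \<open>a\<close> applies.\<close>

lemma nn_integral_PiM_replace_weight:
  fixes G :: "real measure" and a b :: "real \<Rightarrow> ennreal"
  assumes "prob_space G" and sets_G [measurable_cong]: "sets G = sets borel"
    and [measurable]: "T \<in> borel_measurable borel" "a \<in> borel_measurable borel" "b \<in> borel_measurable borel"
    and le: "\<And>\<psi>. \<psi> \<in> borel_measurable borel \<Longrightarrow>
      (\<integral>\<^sup>+y. \<psi> (T y) * b y \<partial>G) \<le> (\<integral>\<^sup>+y. \<psi> (T y) * a y \<partial>G)"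
    and "finite I" and "\<Psi> \<in> borel_measurable (\<Pi>\<^sub>M i\<in>I. borel)"
  shows "(\<integral>\<^sup>+f. \<Psi> (\<lambda>i\<in>I. T (f i)) * (\<Prod>i\<in>I. b (f i)) \<partial>(\<Pi>\<^sub>M i\<in>I. G))
    \<le> (\<integral>\<^sup>+f. \<Psi> (\<lambda>i\<in>I. T (f i)) * (\<Prod>i\<in>I. a (f i)) \<partial>(\<Pi>\<^sub>M i\<in>I. G))"
  using assms(7,8)
proof (induction I arbitrary: \<Psi> rule: finite_induct)
  case empty
  then show ?case by simp
next
  case (insert i I)
  note [measurable] = insert.prems
  interpret G: prob_space G by fact
  interpret P: product_sigma_finite "\<lambda>_. G" by standard
  note [simp] = insert.hyps
  have upd: "(\<lambda>j\<in>insert i I. T ((f(i := y)) j)) = (\<lambda>j\<in>I. T (f j))(i := T y)" for f y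
    using insert.hyps by (auto simp: fun_eq_iff)
  have prod: "(\<Prod>j\<in>insert i I. w ((f(i := y)) j)) = w y * (\<Prod>j\<in>I. w (f j))"
    for w :: "real \<Rightarrow> ennreal" and f y
    using insert.hyps by (simp, intro arg_cong[where f="(*) (w y)"] prod.cong) auto
  have [measurable]: "(\<lambda>t. \<Psi> ((\<lambda>j\<in>I. T (f j))(i := t))) \<in> borel_measurable borel" for f
  proof -
    have "(\<lambda>t. (\<lambda>j\<in>I. T (f j))(i := t)) \<in> borel \<rightarrow>\<^sub>M (\<Pi>\<^sub>M j\<in>insert i I. borel)"
      by (intro measurable_PiM_single') (auto simp: space_PiM extensional_def PiE_def)
    from measurable_compose[OF this insert.prems] show ?thesis .
  qed
  have [measurable]: "(\<lambda>g. \<Psi> (g(i := t))) \<in> borel_measurable (\<Pi>\<^sub>M j\<in>I. borel)" for t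
  proof -
    have "(\<lambda>g. g(i := t)) \<in> (\<Pi>\<^sub>M j\<in>I. borel) \<rightarrow>\<^sub>M (\<Pi>\<^sub>M j\<in>insert i I. borel)"
      by (rule measurable_fun_upd[where J=I]) auto
    from measurable_compose[OF this insert.prems] show ?thesis .
  qed
  have "(\<integral>\<^sup>+f. \<Psi> (\<lambda>j\<in>insert i I. T (f j)) * (\<Prod>j\<in>insert i I. b (f j)) \<partial>(\<Pi>\<^sub>M j\<in>insert i I. G))
      = (\<integral>\<^sup>+f. (\<integral>\<^sup>+y. (\<Psi> ((\<lambda>j\<in>I. T (f j))(i := T y)) * (\<Prod>j\<in>I. b (f j))) * b y \<partial>G) \<partial>(\<Pi>\<^sub>M j\<in>I. G))"
    by (subst P.product_nn_integral_insert) (simp_all only: upd prod ac_simps insert.hyps not_False_eq_True, measurable)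
  also have "\<dots> \<le> (\<integral>\<^sup>+f. (\<integral>\<^sup>+y. (\<Psi> ((\<lambda>j\<in>I. T (f j))(i := T y)) * (\<Prod>j\<in>I. b (f j))) * a y \<partial>G) \<partial>(\<Pi>\<^sub>M j\<in>I. G))"
    by (intro nn_integral_mono le) measurable
  also have "\<dots> = (\<integral>\<^sup>+f. \<Psi> (\<lambda>j\<in>insert i I. T (f j)) * (a (f i) * (\<Prod>j\<in>I. b (f j))) \<partial>(\<Pi>\<^sub>M j\<in>insert i I. G))"
  proof (subst P.product_nn_integral_insert)
    show "(\<integral>\<^sup>+f. (\<integral>\<^sup>+y. (\<Psi> ((\<lambda>j\<in>I. T (f j))(i := T y)) * (\<Prod>j\<in>I. b (f j))) * a y \<partial>G) \<partial>(\<Pi>\<^sub>M j\<in>I. G)) =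
      (\<integral>\<^sup>+f. (\<integral>\<^sup>+y. \<Psi> (\<lambda>j\<in>insert i I. T ((f(i := y)) j)) * (a ((f(i := y)) i) * (\<Prod>j\<in>I. b ((f(i := y)) j))) \<partial>G) \<partial>(\<Pi>\<^sub>M j\<in>I. G))"
      unfolding upd using insert.hyps
      by (intro nn_integral_cong) (auto simp: ac_simps intro!: arg_cong2[where f="(*)"] prod.cong)
  qed (use insert.hyps in \<open>auto\<close>)
  \<comment> \<open>The new coordinate moves outermost, so that for fixed \<open>y\<close> the
    induction hypothesis applies with \<open>a y\<close> absorbed into the functional.\<close>
  also have "\<dots> = (\<integral>\<^sup>+y. (\<integral>\<^sup>+f. (\<Psi> ((\<lambda>j\<in>I. T (f j))(i := T y)) * a y) * (\<Prod>j\<in>I. b (f j)) \<partial>(\<Pi>\<^sub>M j\<in>I. G)) \<partial>G)"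
  proof (subst P.product_nn_integral_insert_rev)
    show "(\<integral>\<^sup>+y. (\<integral>\<^sup>+f. \<Psi> (\<lambda>j\<in>insert i I. T ((f(i := y)) j)) * (a ((f(i := y)) i) * (\<Prod>j\<in>I. b ((f(i := y)) j))) \<partial>(\<Pi>\<^sub>M j\<in>I. G)) \<partial>G) =
      (\<integral>\<^sup>+y. (\<integral>\<^sup>+f. (\<Psi> ((\<lambda>j\<in>I. T (f j))(i := T y)) * a y) * (\<Prod>j\<in>I. b (f j)) \<partial>(\<Pi>\<^sub>M j\<in>I. G)) \<partial>G)"
      unfolding upd using insert.hyps
      by (intro nn_integral_cong) (auto simp: ac_simps intro!: arg_cong2[where f="(*)"] prod.cong)
  qed (use insert.hyps in \<open>auto\<close>)
  also have "\<dots> \<le> (\<integral>\<^sup>+y. (\<integral>\<^sup>+f. (\<Psi> ((\<lambda>j\<in>I. T (f j))(i := T y)) * a y) * (\<Prod>j\<in>I. a (f j)) \<partial>(\<Pi>\<^sub>M j\<in>I. G)) \<partial>G)"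
    by (intro nn_integral_mono insert.IH[where \<Psi>="\<lambda>g. \<Psi> (g(i := T y)) * a y" for y]) measurable
  also have "\<dots> = (\<integral>\<^sup>+f. \<Psi> (\<lambda>j\<in>insert i I. T (f j)) * (\<Prod>j\<in>insert i I. a (f j)) \<partial>(\<Pi>\<^sub>M j\<in>insert i I. G))"
    by (subst P.product_nn_integral_insert_rev) (simp_all only: upd prod ac_simps insert.hyps not_False_eq_True, measurable)
  finally show ?case .
qed

context real_distribution
begin

lemma emeasure_Ioi: "emeasure M {x<..} = ennreal (1 - cdf M x)"
  using prob_compl[of "{..x}"]
  by (simp add: emeasure_eq_measure cdf_def Compl_eq_Diff_UNIV[symmetric] Compl_atMost)

text \<open>
  The coordinatewise submartingale property: the weight \<open>exp c\<close> on \<open>{..q}\<close> dominates the exponential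
  of its conditional mean given \<open>min y x\<close>. Any value above \<open>x\<close>, here \<open>x + 1\<close>, stands for the
  event \<open>y > x\<close>.
\<close>

lemma stopped_weight_le:
  fixes c x q :: real
  assumes "x \<le> q" "cdf M q < 1" and [measurable]: "\<psi> \<in> borel_measurable borel"
  defines "\<theta> \<equiv> (cdf M q - cdf M x) / (1 - cdf M x)"
  shows "(\<integral>\<^sup>+y. \<psi> (if y \<le> x then y else x + 1) * ennreal (if y \<le> x then exp c else exp (c * \<theta>)) \<partial>M)
    \<le> (\<integral>\<^sup>+y. \<psi> (if y \<le> x then y else x + 1) * ennreal (if y \<le> q then exp c else 1) \<partial>M)"
proof -
  have F: "cdf M x \<le> cdf M q" "cdf M x < 1" "0 \<le> \<theta>" "\<theta> \<le> 1"
    using cdf_nondecreasing[OF assms(1)] assms(2) by (auto simp: \<theta>_def)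
  have m: "emeasure M {x<..q} = ennreal (cdf M q - cdf M x)"
    using assms(1) cdf_diff_eq[of x q] by (cases "x = q") (auto simp: emeasure_eq_measure)
  have "(\<integral>\<^sup>+y. \<psi> (if y \<le> x then y else x + 1) * ennreal (if y \<le> x then exp c else exp (c * \<theta>)) \<partial>M)
     = (\<integral>\<^sup>+y. \<psi> y * ennreal (exp c) * indicator {..x} y + \<psi> (x + 1) * ennreal (exp (c * \<theta>)) * indicator {x<..} y \<partial>M)"
    by (intro nn_integral_cong) (auto split: split_indicator)
  also have "\<dots> = (\<integral>\<^sup>+y. \<psi> y * ennreal (exp c) * indicator {..x} y \<partial>M)
      + \<psi> (x + 1) * (ennreal (exp (c * \<theta>)) * ennreal (1 - cdf M x))"
    by (simp add: nn_integral_add nn_integral_cmult_indicator emeasure_Ioi flip: mult.assoc)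
  also have "\<dots> \<le> (\<integral>\<^sup>+y. \<psi> y * ennreal (exp c) * indicator {..x} y \<partial>M)
      + \<psi> (x + 1) * (ennreal (exp c) * ennreal (cdf M q - cdf M x) + ennreal (1 - cdf M q))"
  proof (intro add_left_mono mult_left_mono)
    \<comment> \<open>\<open>\<theta>\<close> is the conditional probability of
      \<open>y \<le> q\<close> given \<open>y > x\<close>; the chord bound is Jensen's inequality
      for this Bernoulli variable.\<close>
    have "exp (c * \<theta>) * (1 - cdf M x) \<le> (\<theta> * exp c + (1 - \<theta>)) * (1 - cdf M x)"
      using F by (intro mult_right_mono exp_convex_combination_le) auto
    also have "\<dots> = exp c * (\<theta> * (1 - cdf M x)) + ((1 - cdf M x) - \<theta> * (1 - cdf M x))"
      by (simp add: algebra_simps)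
    also have "\<theta> * (1 - cdf M x) = cdf M q - cdf M x"
      using F by (simp add: \<theta>_def)
    finally show "ennreal (exp (c * \<theta>)) * ennreal (1 - cdf M x)
        \<le> ennreal (exp c) * ennreal (cdf M q - cdf M x) + ennreal (1 - cdf M q)"
      using F assms(2) by (simp add: ennreal_mult[symmetric] ennreal_plus[symmetric] del: ennreal_plus)
  qed simp
  also have "\<dots> = (\<integral>\<^sup>+y. \<psi> y * ennreal (exp c) * indicator {..x} y
      + (\<psi> (x + 1) * ennreal (exp c) * indicator {x<..q} y + \<psi> (x + 1) * indicator {q<..} y) \<partial>M)"
    by (simp add: nn_integral_add nn_integral_cmult_indicator emeasure_Ioi m distrib_left flip: mult.assoc)
  also have "\<dots> = (\<integral>\<^sup>+y. \<psi> (if y \<le> x then y else x + 1) * ennreal (if y \<le> q then exp c else 1) \<partial>M)"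
    using assms(1) by (intro nn_integral_cong) (auto split: split_indicator)
  finally show ?thesis .
qed

text \<open>
  Doob's maximal inequality for \<open>exp (c * (F x - cdf x) / (1 - cdf x))\<close> up to \<open>q\<close>, where \<open>F\<close> is the
  empirical distribution function; \<open>c\<close> is the minimiser of the Hoeffding bound at \<open>q\<close>. The samples
  are split according to the first point of \<open>D\<close> where the deviation exceeds \<open>v\<close>.
\<close>

lemma finite_crossing_prob_le:
  fixes I :: "'i set" and s v A q :: real
  assumes "finite I" "I \<noteq> {}" "finite D" "v > 0" "cdf M q < 1" "s \<in> {1, -1}"
    and D: "\<And>x. x \<in> D \<Longrightarrow> x \<le> q \<and> 1 - cdf M x \<le> A"
  defines "E \<equiv> (\<lambda>x f. s * ((\<Sum>i\<in>I. indicator {..x} (f i)) - card I * cdf M x) > card I * v)"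
  shows "measure (\<Pi>\<^sub>M i\<in>I. M) {f \<in> space (\<Pi>\<^sub>M i\<in>I. M). \<exists>x\<in>D. E x f}
    \<le> exp (- 2 * card I * v\<^sup>2 * ((1 - cdf M q) / A)\<^sup>2)"
proof -
  interpret P: product_sigma_finite "\<lambda>_. M" by standard
  interpret PP: prob_space "\<Pi>\<^sub>M i\<in>I. M"
    by (intro prob_space_PiM) (rule prob_space_axioms)
  let ?P = "\<Pi>\<^sub>M i\<in>I. M"
  define N where "N = real (card I)"
  \<comment> \<open>Given the sample up to \<open>x\<close>, the mean deviation at \<open>q\<close>
    is the deviation at \<open>x\<close> times \<open>(1 - cdf M q) / (1 - cdf M x)\<close>;
    \<open>\<rho>\<close> bounds this factor from below for all points of \<open>D\<close>.\<close>
  define \<rho> where "\<rho> = (1 - cdf M q) / A"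
  define c where "c = s * (4 * v * \<rho>)"
  define First where "First = (\<lambda>x. {f \<in> space ?P. E x f \<and> (\<forall>y\<in>D. y < x \<longrightarrow> \<not> E y f)})"
  \<comment> \<open>Where the deviation exceeds \<open>v\<close>, the exponential of
    \<open>c\<close> times the conditional mean count at \<open>q\<close> is at least
    \<open>K\<close>.\<close>
  define K where "K = exp (c * N * cdf M q + N * (4 * v * \<rho>) * v * \<rho>)"
  define w where "w = (\<lambda>y. ennreal (if y \<le> q then exp c else 1))"
  have N: "N > 0" using assms by (simp add: N_def card_gt_0_iff)
  have count_meas [measurable]: "(\<lambda>f. \<Sum>i\<in>I. indicator {..x} (f i) :: real) \<in> borel_measurable ?P" for x
    by measurable
  have [measurable]: "Measurable.pred ?P (E x)" for x
    unfolding E_def by measurable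
  have [measurable]: "First x \<in> sets ?P" for x
    unfolding First_def using \<open>finite D\<close> by measurable
  have w_meas [measurable]: "w \<in> borel_measurable borel"
    unfolding w_def by measurable
  have sets_PP [measurable_cong]: "sets ?P = sets (\<Pi>\<^sub>M i\<in>I. borel)"
    by (intro sets_PiM_cong) simp_all
  \<comment> \<open>Markov's inequality on a first crossing at \<open>x\<close>: there the product
    of the stopped weights is at least \<open>K\<close>, and \<open>First x\<close> depends only on
    the stopped sample, so the weights \<open>w\<close> at \<open>q\<close> may replace the stopped
    ones.\<close>
  have step: "ennreal K * emeasure ?P (First x) \<le> (\<integral>\<^sup>+f. indicator (First x) f * (\<Prod>i\<in>I. w (f i)) \<partial>?P)"
    if "x \<in> D" for x
  proof -
    define \<theta> where "\<theta> = (cdf M q - cdf M x) / (1 - cdf M x)"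
    define T where "T = (\<lambda>y. if y \<le> x then y else x + 1)"
    define b where "b = (\<lambda>y. ennreal (if y \<le> x then exp c else exp (c * \<theta>)))"
    have xq: "x \<le> q" "1 - cdf M x \<le> A" "cdf M x < 1" and Fle: "cdf M x \<le> cdf M q"
      using D[OF that] cdf_nondecreasing[of x q] assms(5) by auto
    have [measurable]: "T \<in> borel_measurable borel" "b \<in> borel_measurable borel"
      unfolding T_def b_def by measurable
    \<comment> \<open>\<open>T\<close> fixes values up to \<open>x\<close> and keeps all others
      above \<open>x\<close>, so the counts at levels \<open>y \<le> x\<close> do not
      change.\<close>
    have ET: "E y (\<lambda>i\<in>I. T (f i)) \<longleftrightarrow> E y f" if "y \<le> x" for y f
    proof -
      have "(\<Sum>i\<in>I. indicator {..y} ((\<lambda>i\<in>I. T (f i)) i)) = (\<Sum>i\<in>I. indicator {..y} (f i) :: real)"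
        using that by (intro sum.cong) (auto simp: T_def indicator_def)
      then show ?thesis by (simp add: E_def)
    qed
    have FT: "indicator (First x) (\<lambda>i\<in>I. T (f i)) = (indicator (First x) f :: ennreal)"
      if "f \<in> space ?P" for f
      using that ET by (auto simp: First_def space_PiM indicator_def PiE_iff)
    have "ennreal K * emeasure ?P (First x) = (\<integral>\<^sup>+f. ennreal K * indicator (First x) f \<partial>?P)"
      by (simp add: nn_integral_cmult_indicator)
    also have "\<dots> \<le> (\<integral>\<^sup>+f. indicator (First x) (\<lambda>i\<in>I. T (f i)) * (\<Prod>i\<in>I. b (f i)) \<partial>?P)"
    proof (intro nn_integral_mono)
      fix f assume f: "f \<in> space ?P"
      have "K \<le> (\<Prod>i\<in>I. if f i \<le> x then exp c else exp (c * \<theta>))" if "f \<in> First x"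
      proof -
        define k where "k = (\<Sum>i\<in>I. indicator {..x} (f i) :: real)"
        have "s * (k - N * cdf M x) > N * v"
          using that by (auto simp: First_def E_def k_def N_def)
        then have k: "s * (k - N * cdf M x) \<ge> N * v" by simp
        have \<rho>_le: "\<rho> \<le> (1 - cdf M q) / (1 - cdf M x)"
          unfolding \<rho>_def using xq assms(5) by (intro divide_left_mono) auto
        have \<rho>0: "0 \<le> \<rho>" unfolding \<rho>_def using xq assms(5) by auto
        \<comment> \<open>The \<open>k\<close> points up to \<open>x\<close> count fully, the others
          with weight \<open>\<theta>\<close>. Centring \<open>k\<close> splits the exponent into
          the mean count at \<open>q\<close> and the shrunken deviation.\<close>
        have "(\<Sum>i\<in>I. if f i \<le> x then c else c * \<theta>) = (\<Sum>i\<in>I. c * \<theta> + c * (1 - \<theta>) * indicator {..x} (f i))"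
          by (intro sum.cong) (auto simp: algebra_simps)
        also have "\<dots> = N * (c * \<theta>) + c * (1 - \<theta>) * k"
          by (simp add: sum.distrib k_def N_def sum_distrib_left)
        also have "\<dots> = c * N * (\<theta> + (1 - \<theta>) * cdf M x) + c * (1 - \<theta>) * (k - N * cdf M x)"
          by (simp add: algebra_simps)
        also have "\<theta> + (1 - \<theta>) * cdf M x = 1 - (1 - \<theta>) * (1 - cdf M x)"
          by (simp add: algebra_simps)
        also have "1 - \<theta> = (1 - cdf M q) / (1 - cdf M x)"
          using xq by (simp add: \<theta>_def field_simps)
        also have "1 - (1 - cdf M q) / (1 - cdf M x) * (1 - cdf M x) = cdf M q"
          using xq by simp
        also have "c * ((1 - cdf M q) / (1 - cdf M x)) * (k - N * cdf M x)
            = (4 * v * \<rho>) * (((1 - cdf M q) / (1 - cdf M x)) * (s * (k - N * cdf M x)))"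
          by (simp add: c_def)
        finally have eq: "(\<Sum>i\<in>I. if f i \<le> x then c else c * \<theta>) = c * N * cdf M q +
            (4 * v * \<rho>) * (((1 - cdf M q) / (1 - cdf M x)) * (s * (k - N * cdf M x)))" .
        have "(4 * v * \<rho>) * (\<rho> * (N * v)) \<le> (4 * v * \<rho>) * (((1 - cdf M q) / (1 - cdf M x)) * (s * (k - N * cdf M x)))"
          using \<rho>0 N \<open>v > 0\<close> xq assms(5)
          by (intro mult_left_mono[OF mult_mono[OF \<rho>_le k]]) auto
        then have "K \<le> exp (\<Sum>i\<in>I. if f i \<le> x then c else c * \<theta>)"
          unfolding K_def eq by (simp add: ac_simps)
        also have "\<dots> = (\<Prod>i\<in>I. if f i \<le> x then exp c else exp (c * \<theta>))"
          using \<open>finite I\<close> by (simp add: exp_sum if_distrib cong: if_cong)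
        finally show ?thesis .
      qed
      then have "f \<in> First x \<Longrightarrow> ennreal K \<le> (\<Prod>i\<in>I. b (f i))"
        unfolding b_def by (subst prod_ennreal) (auto intro!: ennreal_leI)
      then show "ennreal K * indicator (First x) f \<le> indicator (First x) (\<lambda>i\<in>I. T (f i)) * (\<Prod>i\<in>I. b (f i))"
        by (auto simp: FT[OF f] split: split_indicator)
    qed
    also have "\<dots> \<le> (\<integral>\<^sup>+f. indicator (First x) (\<lambda>i\<in>I. T (f i)) * (\<Prod>i\<in>I. w (f i)) \<partial>?P)"
    proof (rule nn_integral_PiM_replace_weight[where G=M and T=T and b=b and a=w and \<Psi>="indicator (First x)"])
      show "(\<integral>\<^sup>+y. \<psi> (T y) * b y \<partial>M) \<le> (\<integral>\<^sup>+y. \<psi> (T y) * w y \<partial>M)" if "\<psi> \<in> borel_measurable borel" for \<psi>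
        using stopped_weight_le[OF xq(1) assms(5) that, of c]
          unfolding T_def b_def w_def \<theta>_def .
      show "indicator (First x) \<in> borel_measurable (\<Pi>\<^sub>M i\<in>I. borel)"
        by (rule borel_measurable_indicator) (simp add: sets_PP[symmetric])
    qed (simp_all add: \<open>finite I\<close> prob_space_axioms)
    also have "\<dots> = (\<integral>\<^sup>+f. indicator (First x) f * (\<Prod>i\<in>I. w (f i)) \<partial>?P)"
      by (intro nn_integral_cong) (simp add: FT)
    finally show ?thesis .
  qed
  have union: "{f \<in> space ?P. \<exists>x\<in>D. E x f} = (\<Union>x\<in>D. First x)"
  proof (intro equalityI subsetI)
    fix f assume f: "f \<in> {f \<in> space ?P. \<exists>x\<in>D. E x f}"
    let ?C = "{x\<in>D. E x f}"
    have "finite ?C" "?C \<noteq> {}" using f \<open>finite D\<close> by auto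
    then have "Min ?C \<in> ?C" by (rule Min_in)
    moreover have "\<forall>y\<in>D. y < Min ?C \<longrightarrow> \<not> E y f"
      using Min_le[OF \<open>finite ?C\<close>] by (metis (mono_tags, lifting) leD mem_Collect_eq)
    ultimately show "f \<in> (\<Union>x\<in>D. First x)"
      using f by (auto simp: First_def)
  qed (auto simp: First_def)
  have disj: "disjoint_family_on First D"
    unfolding disjoint_family_on_def
  proof (intro ballI impI)
    fix x y assume "x \<in> D" "y \<in> D" "x \<noteq> y"
    then show "First x \<inter> First y = {}"
      by (cases x y rule: linorder_cases) (auto simp: First_def)
  qed
  \<comment> \<open>Disjointness of the first-crossing events bounds the sum over \<open>D\<close>
    by one expectation, which factorises over the coordinates.\<close>
  have "ennreal K * emeasure ?P (\<Union>x\<in>D. First x) = (\<Sum>x\<in>D. ennreal K * emeasure ?P (First x))"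
    using \<open>finite D\<close> disj by (simp add: sum_emeasure[symmetric] sum_distrib_left image_subset_iff)
  also have "\<dots> \<le> (\<Sum>x\<in>D. \<integral>\<^sup>+f. indicator (First x) f * (\<Prod>i\<in>I. w (f i)) \<partial>?P)"
    by (intro sum_mono step)
  also have "\<dots> = (\<integral>\<^sup>+f. (\<Sum>x\<in>D. indicator (First x) f) * (\<Prod>i\<in>I. w (f i)) \<partial>?P)"
    by (subst nn_integral_sum[symmetric]) (auto simp: sum_distrib_right)
  also have "\<dots> \<le> (\<integral>\<^sup>+f. (\<Prod>i\<in>I. w (f i)) \<partial>?P)"
  proof (intro nn_integral_mono)
    fix f
    have "(\<Sum>x\<in>D. indicator (First x) f) = (indicator (\<Union>x\<in>D. First x) f :: ennreal)"
      using \<open>finite D\<close> disj by (rule indicator_UN_disjoint[symmetric])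
    then show "(\<Sum>x\<in>D. indicator (First x) f) * (\<Prod>i\<in>I. w (f i)) \<le> (\<Prod>i\<in>I. w (f i))"
      by (auto split: split_indicator)
  qed
  also have "\<dots> = (\<Prod>i\<in>I. \<integral>\<^sup>+y. w y \<partial>M)"
    using \<open>finite I\<close> by (intro P.product_nn_integral_prod) measurable
  also have "\<dots> = (\<integral>\<^sup>+y. w y \<partial>M) ^ card I" by simp
  also have "(\<integral>\<^sup>+y. w y \<partial>M) = (\<integral>\<^sup>+y. ennreal (exp c) * indicator {..q} y + indicator {q<..} y \<partial>M)"
    by (intro nn_integral_cong) (auto simp: w_def split: split_indicator)
  also have "\<dots> = ennreal (exp c) * emeasure M {..q} + emeasure M {q<..}"
    by (simp add: nn_integral_add nn_integral_cmult_indicator)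
  also have "\<dots> = ennreal (cdf M q * exp c + (1 - cdf M q))"
    using assms(5) unfolding emeasure_Ioi
    by (simp add: emeasure_eq_measure cdf_def ennreal_mult[symmetric] ennreal_plus[symmetric] mult.commute del: ennreal_plus)
  also have "\<dots> ^ card I \<le> ennreal (exp (c * cdf M q + c\<^sup>2 / 8)) ^ card I"
    using assms(5) by (intro power_mono ennreal_leI bernoulli_mgf_le) (auto simp: cdf_nonneg)
  also have "\<dots> = ennreal (exp (N * (c * cdf M q + c\<^sup>2 / 8)))"
    by (simp add: ennreal_power exp_of_nat_mult N_def)
  finally have "ennreal K * ennreal (measure ?P {f \<in> space ?P. \<exists>x\<in>D. E x f}) \<le> ennreal (exp (N * (c * cdf M q + c\<^sup>2 / 8)))"
    unfolding union PP.emeasure_eq_measure .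
  then have "K * measure ?P {f \<in> space ?P. \<exists>x\<in>D. E x f} \<le> exp (N * (c * cdf M q + c\<^sup>2 / 8))"
    by (simp add: ennreal_mult[symmetric] K_def)
  then have "measure ?P {f \<in> space ?P. \<exists>x\<in>D. E x f} \<le> exp (N * (c * cdf M q + c\<^sup>2 / 8)) / K"
    by (simp add: K_def pos_le_divide_eq mult.commute)
  also have "\<dots> = exp (N * (c * cdf M q + c\<^sup>2 / 8) - (c * N * cdf M q + N * (4 * v * \<rho>) * v * \<rho>))"
    by (simp add: K_def exp_diff)
  also have "N * (c * cdf M q + c\<^sup>2 / 8) - (c * N * cdf M q + N * (4 * v * \<rho>) * v * \<rho>) = - 2 * N * v\<^sup>2 * \<rho>\<^sup>2"
  proof -
    have "s\<^sup>2 = 1" using assms(6) by auto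
    then have "c\<^sup>2 = 16 * v\<^sup>2 * \<rho>\<^sup>2" by (simp add: c_def power_mult_distrib)
    then show ?thesis by (simp add: algebra_simps power2_eq_square)
  qed
  finally show ?thesis by (simp add: N_def \<rho>_def)
qed

end

context real_distribution
begin

text \<open>The finite bound does not depend on the size of \<open>D\<close>, so continuity of the
  measure along an enumeration of \<open>D\<close> carries it over.\<close>

lemma countable_crossing_prob_le:
  fixes I :: "'i set" and s v A q :: real
  assumes "finite I" "I \<noteq> {}" "countable D" "v > 0" "cdf M q < 1" "s \<in> {1, -1}"
    and D: "\<And>x. x \<in> D \<Longrightarrow> x \<le> q \<and> 1 - cdf M x \<le> A"
  defines "E \<equiv> (\<lambda>x f. s * ((\<Sum>i\<in>I. indicator {..x} (f i)) - card I * cdf M x) > card I * v)"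
  shows "measure (\<Pi>\<^sub>M i\<in>I. M) {f \<in> space (\<Pi>\<^sub>M i\<in>I. M). \<exists>x\<in>D. E x f}
    \<le> exp (- 2 * card I * v\<^sup>2 * ((1 - cdf M q) / A)\<^sup>2)"
proof (cases "D = {}")
  case False
  let ?P = "\<Pi>\<^sub>M i\<in>I. M"
  interpret PP: prob_space ?P
    by (intro prob_space_PiM) (rule prob_space_axioms)
  have [measurable]: "Measurable.pred ?P (E x)" for x
    unfolding E_def by measurable
  define B where "B n = {f \<in> space ?P. \<exists>x\<in>from_nat_into D ` {..<n}. E x f}" for n
  have "incseq B" by (auto simp: incseq_def B_def)
  have meas: "range B \<subseteq> sets ?P" unfolding B_def by (auto, measurable)
  have "(\<lambda>n. measure ?P (B n)) \<longlonglongrightarrow> measure ?P (\<Union>n. B n)"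
    using meas \<open>incseq B\<close> by (rule PP.finite_Lim_measure_incseq)
  moreover have "measure ?P (B n) \<le> exp (- 2 * card I * v\<^sup>2 * ((1 - cdf M q) / A)\<^sup>2)" for n
  proof -
    have "from_nat_into D ` {..<n} \<subseteq> D" using False by (auto intro: from_nat_into)
    then show ?thesis
      unfolding B_def E_def using assms(1,2,4-6) D
      by (intro finite_crossing_prob_le) blast+
  qed
  ultimately have "measure ?P (\<Union>n. B n) \<le> exp (- 2 * card I * v\<^sup>2 * ((1 - cdf M q) / A)\<^sup>2)"
    by (intro LIMSEQ_le_const2) auto
  moreover have "{f \<in> space ?P. \<exists>x\<in>D. E x f} = (\<Union>n. B n)"
    using assms(3) False by (fastforce simp: B_def dest: from_nat_into_surj intro: from_nat_into)
  ultimately show ?thesis by simp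
qed simp

lemma cdf_quantile:
  assumes cont: "\<And>x. isCont (cdf M) x" and "0 < p" "p < 1"
  obtains q where "cdf M q = p"
proof -
  have "eventually (\<lambda>x. cdf M x < p) at_bot"
    using cdf_lim_at_bot \<open>0 < p\<close> by (rule order_tendstoD)
  then obtain a where a: "\<And>x. x \<le> a \<Longrightarrow> cdf M x < p" by (auto simp: eventually_at_bot_linorder)
  have "eventually (\<lambda>x. cdf M x > p) at_top"
    using cdf_lim_at_top_prob \<open>p < 1\<close> by (rule order_tendstoD)
  then obtain b where b: "\<And>x. b \<le> x \<Longrightarrow> cdf M x > p" by (auto simp: eventually_at_top_linorder)
  have "\<exists>x\<ge>min a b. x \<le> max a b \<and> cdf M x = p"
    using a[of "min a b"] b[of "max a b"] cont by (intro IVT) auto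
  then show ?thesis using that by blast
qed

text \<open>
  The half line is cut at the points where \<open>1 - cdf\<close> equals a power of \<open>21 / 25\<close>; four pieces
  suffice because \<open>(21 / 25) ^ 4 < 1 / 2\<close>.
\<close>

lemma half_line_crossing_prob_le:
  fixes I :: "'i set" and s v :: real
  assumes "finite I" "I \<noteq> {}" "countable D" "v > 0" "s \<in> {1, -1}"
    and cont: "\<And>x. isCont (cdf M) x"
    and half: "\<And>x. x \<in> D \<Longrightarrow> cdf M x \<le> 1 / 2"
  defines "E \<equiv> (\<lambda>x f. s * ((\<Sum>i\<in>I. indicator {..x} (f i)) - card I * cdf M x) > card I * v)"
  shows "measure (\<Pi>\<^sub>M i\<in>I. M) {f \<in> space (\<Pi>\<^sub>M i\<in>I. M). \<exists>x\<in>D. E x f}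
    \<le> 4 * exp (- 2 * card I * v\<^sup>2 * (21 / 25)\<^sup>2)"
proof -
  let ?P = "\<Pi>\<^sub>M i\<in>I. M"
  interpret PP: prob_space ?P
    by (intro prob_space_PiM) (rule prob_space_axioms)
  define \<rho> :: real where "\<rho> = 21 / 25"
  define S where "S k = {x \<in> D. 1 - \<rho> ^ k \<le> cdf M x \<and> cdf M x < 1 - \<rho> ^ Suc k}" for k
  have [measurable]: "Measurable.pred ?P (E x)" for x
    unfolding E_def by measurable
  have S: "countable (S k)" for k
    using assms(3) by (auto simp: S_def intro: countable_subset)
  have [measurable]: "{f \<in> space ?P. \<exists>x\<in>S k. E x f} \<in> sets ?P" for k
    using S[of k] by measurable
  \<comment> \<open>On every piece the ratio of the tails at its two ends is \<open>\<rho>\<close>,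
    so all pieces share one bound.\<close>
  have piece: "measure ?P {f \<in> space ?P. \<exists>x\<in>S k. E x f} \<le> exp (- 2 * card I * v\<^sup>2 * \<rho>\<^sup>2)" for k
  proof -
    have "0 < \<rho> ^ Suc k" "\<rho> ^ Suc k < 1"
      unfolding \<rho>_def by (simp, intro power_Suc_less_one) auto
    then obtain q where q: "cdf M q = 1 - \<rho> ^ Suc k"
      by (metis cdf_quantile[OF cont] diff_gt_0_iff_gt diff_less_eq less_add_same_cancel1)
    have "x \<le> q \<and> 1 - cdf M x \<le> \<rho> ^ k" if "x \<in> S k" for x
      using that q cdf_nondecreasing[of q x] by (force simp: S_def)
    moreover have "(1 - cdf M q) / \<rho> ^ k = \<rho>"
      unfolding q by (simp add: \<rho>_def)
    moreover have "cdf M q < 1" using q \<open>0 < \<rho> ^ Suc k\<close> by simp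
    ultimately show ?thesis
      using countable_crossing_prob_le[OF assms(1,2) S assms(4) _ assms(5), of q k "\<rho> ^ k"]
      by (simp add: E_def)
  qed
  have "\<exists>k<4. x \<in> S k" if "x \<in> D" for x
  proof (rule ccontr)
    assume *: "\<not> ?thesis"
    have "1 - \<rho> ^ k \<le> cdf M x" if "k \<le> 4" for k
      using that
    proof (induction k)
      case 0
      then show ?case by (simp add: cdf_nonneg)
    next
      case (Suc k)
      then show ?case using * \<open>x \<in> D\<close> by (auto simp: S_def not_less)
    qed
    from this[of 4] have "1 - \<rho> ^ 4 \<le> cdf M x" by simp
    also have "\<dots> \<le> 1 / 2" using half that by blast
    finally show False by (simp add: \<rho>_def field_simps)
  qed
  then have "{f \<in> space ?P. \<exists>x\<in>D. E x f} \<subseteq> (\<Union>k<4. {f \<in> space ?P. \<exists>x\<in>S k. E x f})"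
    by fast
  then have "measure ?P {f \<in> space ?P. \<exists>x\<in>D. E x f} \<le> measure ?P (\<Union>k<4. {f \<in> space ?P. \<exists>x\<in>S k. E x f})"
    by (intro PP.finite_measure_mono) auto
  also have "\<dots> \<le> (\<Sum>k<4. measure ?P {f \<in> space ?P. \<exists>x\<in>S k. E x f})"
    by (intro PP.finite_measure_subadditive_finite) auto
  also have "\<dots> \<le> (\<Sum>k<(4::nat). exp (- 2 * card I * v\<^sup>2 * \<rho>\<^sup>2))"
    by (intro sum_mono piece)
  finally show ?thesis by (simp add: \<rho>_def)
qed

end

section \<open>The standard normal distribution function\<close>

abbreviation \<Phi> :: "real \<Rightarrow> real" where "\<Phi> \<equiv> cdf std_normal_distribution"

interpretation gauss: real_distribution std_normal_distribution
  by (rule real_dist_normal_dist)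

lemma isCont_\<Phi>: "isCont \<Phi> x"
proof -
  have "emeasure std_normal_distribution {x} = 0"
    by (subst emeasure_density) (simp_all add: nn_integral_indicator_singleton)
  then show ?thesis
    by (simp add: gauss.isCont_cdf measure_def)
qed

text \<open>The density increases on the negative half line, so its largest value between
  \<open>x\<close> and \<open>y\<close> is the one at \<open>y\<close>.\<close>

lemma \<Phi>_increment_le:
  assumes "x \<le> y" "y \<le> 0"
  shows "\<Phi> y - \<Phi> x \<le> (y - x) * std_normal_density y"
proof (cases "x = y")
  case False
  then have "\<Phi> y - \<Phi> x = measure std_normal_distribution {x<..y}"
    using assms by (intro gauss.cdf_diff_eq) simp
  also have "ennreal \<dots> = (\<integral>\<^sup>+t. ennreal (std_normal_density t) * indicator {x<..y} t \<partial>lborel)"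
    by (simp add: gauss.emeasure_eq_measure[symmetric] emeasure_density)
  also have "\<dots> \<le> (\<integral>\<^sup>+t. ennreal (std_normal_density y) * indicator {x<..y} t \<partial>lborel)"
  proof (intro nn_integral_mono)
    fix t
    show "ennreal (std_normal_density t) * indicator {x<..y} t \<le> ennreal (std_normal_density y) * indicator {x<..y} t"
    proof (cases "t \<in> {x<..y}")
      case True
      then have "y\<^sup>2 \<le> t\<^sup>2" using assms by (simp add: abs_le_square_iff[symmetric])
      then show ?thesis
        by (auto simp: std_normal_density_def intro!: mult_right_mono ennreal_leI divide_right_mono)
    qed simp
  qed
  also have "\<dots> = ennreal ((y - x) * std_normal_density y)"
    using assms by (simp add: nn_integral_cmult_indicator ennreal_mult[symmetric] mult.commute)
  finally show ?thesis
    using assms by (subst (asm) ennreal_le_iff) auto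
qed simp

text \<open>The maximum, at \<open>z = 1\<close> and \<open>z = -1\<close>, is
  \<open>1 / sqrt (2 * pi * exp 1)\<close>. After squaring, the claim is
  \<open>2 * pi * exp 1 \<ge> 16\<close>.\<close>

lemma mult_std_normal_density_le: "\<bar>z\<bar> * std_normal_density z \<le> 1 / 4"
proof -
  have "(\<bar>z\<bar> * std_normal_density z)\<^sup>2 = z\<^sup>2 * exp (- z\<^sup>2) / (2 * pi)"
    by (simp add: std_normal_density_def power_mult_distrib power_divide exp_of_nat_mult[symmetric])
  also have "\<dots> \<le> exp (- 1) / (2 * pi)"
  proof (intro divide_right_mono)
    have "z\<^sup>2 \<le> exp (z\<^sup>2 - 1)" using exp_ge_add_one_self[of "z\<^sup>2 - 1"] by simp
    then have "z\<^sup>2 * exp (- z\<^sup>2) \<le> exp (z\<^sup>2 - 1) * exp (- z\<^sup>2)" by (intro mult_right_mono) auto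
    then show "z\<^sup>2 * exp (- z\<^sup>2) \<le> exp (- 1)" by (simp flip: exp_add)
  qed simp
  also have "\<dots> \<le> (1 / 4)\<^sup>2"
  proof -
    \<comment> \<open>\<open>8 / 3\<close> is exactly what is required of \<open>exp 1\<close> once
      \<open>pi\<close> is replaced by \<open>3\<close>.\<close>
    have "(8 / 3 :: real) \<le> exp 1"
    proof -
      have "(1 + 1 / 4 + (1 / 4)\<^sup>2 / 2 :: real) ^ 4 \<le> exp (1 / 4) ^ 4"
        by (intro power_mono exp_lower_Taylor_quadratic) auto
      also have "exp (1 / 4) ^ 4 = exp (1 :: real)"
        by (simp flip: exp_of_nat_mult)
      finally show ?thesis by (simp add: power2_eq_square field_simps)
    qed
    moreover have "3 < pi" by (rule pi_gt3)
    ultimately have "(8 / 3) * (6 :: real) \<le> exp 1 * (2 * pi)" by (intro mult_mono) auto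
    then show ?thesis by (simp add: exp_minus field_simps power2_eq_square)
  qed
  finally show ?thesis by (rule power2_le_imp_le) simp
qed

text \<open>Writing the increment of the argument as \<open>(1 / r - 1) * \<bar>r * x\<bar>\<close>
  pairs the density with its own argument, which makes the bound uniform in
  \<open>x\<close>.\<close>

lemma \<Phi>_scale_le:
  assumes "x \<le> 0" "0 < r" "r \<le> 1"
  shows "\<Phi> (r * x) \<le> \<Phi> x + (1 / r - 1) / 4"
proof -
  have "\<Phi> (r * x) - \<Phi> x \<le> (r * x - x) * std_normal_density (r * x)"
    using assms mult_right_mono_neg[of r 1 x] by (intro \<Phi>_increment_le) (auto simp: mult_le_0_iff)
  also have "r * x - x = (1 / r - 1) * \<bar>r * x\<bar>"
    using assms by (simp add: abs_mult field_simps)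
  also have "\<dots> * std_normal_density (r * x) = (1 / r - 1) * (\<bar>r * x\<bar> * std_normal_density (r * x))"
    by simp
  also have "\<dots> \<le> (1 / r - 1) * (1 / 4)"
    using assms by (intro mult_left_mono mult_std_normal_density_le) auto
  finally show ?thesis by linarith
qed

lemma \<Phi>_minus: "\<Phi> (- x) = 1 - \<Phi> x"
proof -
  have "emeasure std_normal_distribution {..- x} = (\<integral>\<^sup>+t. ennreal (std_normal_density t) * indicator {..- x} t \<partial>lborel)"
    by (simp add: emeasure_density)
  also have "\<dots> = (\<integral>\<^sup>+t. ennreal (std_normal_density t) * indicator {x..} t \<partial>lborel)"
    by (subst nn_integral_real_affine[where c="-1" and t=0])
       (auto simp: std_normal_density_def intro!: nn_integral_cong split: split_indicator)
  also have "\<dots> = emeasure std_normal_distribution {x..}"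
    by (simp add: emeasure_density)
  finally have "measure std_normal_distribution {..- x} = measure std_normal_distribution {x..}"
    by (simp add: measure_def)
  also have "measure std_normal_distribution {x..} = 1 - measure std_normal_distribution {..<x}"
    using gauss.prob_compl[of "{..<x}"] by (simp add: Compl_eq_Diff_UNIV[symmetric] Compl_lessThan)
  \<comment> \<open>The open half line carries the left limit of \<open>\<Phi>\<close>, equal to
    \<open>\<Phi> x\<close> by continuity.\<close>
  also have "measure std_normal_distribution {..<x} = \<Phi> x"
    using gauss.cdf_at_left[of x] isCont_\<Phi>[of x, unfolded isCont_def filterlim_at_split]
    by (intro tendsto_unique[OF trivial_limit_at_left_real]) auto
  finally show ?thesis by (simp add: cdf_def)
qed

section \<open>The Gaussian measure on Euclidean space\<close>

lemma empirical_cdf_altdef: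
  fixes z :: "real ^ 'n" and F :: "real \<Rightarrow> real"
  shows "empirical_cdf z x - F x = ((\<Sum>i\<in>UNIV. indicator {..x} (z $ i)) - CARD('n) * F x) / CARD('n)"
  by (simp add: empirical_cdf_def field_simps)

lemma measurable_vec_lambda:
  fixes M :: "'n::finite \<Rightarrow> real measure"
  assumes [measurable_cong]: "\<And>i. sets (M i) = sets borel"
  shows "vec_lambda \<in> borel_measurable (Pi\<^sub>M UNIV M)"
proof (rule borel_measurable_euclidean_space[THEN iffD2], intro ballI)
  fix b :: "real ^ 'n" assume "b \<in> Basis"
  then obtain i where b: "b = axis i 1" by (auto simp: Basis_vec_def)
  show "(\<lambda>f. vec_lambda f \<bullet> b) \<in> borel_measurable (Pi\<^sub>M UNIV M)"
    unfolding b inner_axis by simp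
qed

lemma measurable_vec_nth [measurable]: "(\<lambda>z :: real ^ 'n. z $ i) \<in> borel_measurable borel"
  by (intro borel_measurable_continuous_onI continuous_intros)

text \<open>The radial form of the standard normal density serves the polar decomposition;
  \<open>gauss_density_prod\<close> links it to independent coordinates.\<close>

definition gauss_density :: "real ^ 'n \<Rightarrow> real" where
  "gauss_density z = (1 / sqrt (2 * pi)) ^ CARD('n) * exp (- (norm z)\<^sup>2 / 2)"

definition gauss_measure :: "(real ^ 'n) measure" where
  "gauss_measure = density lborel gauss_density"

lemma gauss_density_prod:
  fixes z :: "real ^ 'n"
  shows "gauss_density z = (\<Prod>i\<in>UNIV. std_normal_density (z $ i))"
proof -
  have "- (norm z)\<^sup>2 / 2 = (\<Sum>i\<in>UNIV. - (z $ i)\<^sup>2 / 2)"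
    by (simp add: norm_vec_def L2_set_def sum_nonneg sum_divide_distrib sum_negf)
  then have "gauss_density z = (\<Prod>i\<in>(UNIV :: 'n set). 1 / sqrt (2 * pi)) * (\<Prod>i\<in>UNIV. exp (- (z $ i)\<^sup>2 / 2))"
    by (simp only: gauss_density_def prod_constant exp_sum[OF finite])
  then show ?thesis
    by (simp only: prod.distrib std_normal_density_def)
qed

lemma gauss_density_pos: "0 < gauss_density z"
  by (simp add: gauss_density_def)

lemma gauss_density_measurable [measurable]: "gauss_density \<in> borel_measurable borel"
  unfolding gauss_density_def by measurable

lemma sets_gauss_measure [simp, measurable_cong]: "sets gauss_measure = sets borel"
  by (simp add: gauss_measure_def)

lemma space_gauss_measure [simp]: "space gauss_measure = UNIV"
  by (simp add: gauss_measure_def)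

text \<open>Lebesgue measure is characterised by its values on boxes, so the positive density is
  first divided out of the product law. The quotient gives each box its volume, because every
  coordinate contributes its side length; multiplying back gives the claim.\<close>

lemma gauss_measure_eq_distr:
  "(gauss_measure :: (real ^ 'n) measure) = distr (\<Pi>\<^sub>M i\<in>UNIV. std_normal_distribution) borel vec_lambda"
proof -
  interpret P: product_sigma_finite "\<lambda>_ :: 'n. std_normal_distribution" by standard
  let ?P = "\<Pi>\<^sub>M i\<in>(UNIV :: 'n set). std_normal_distribution"
  let ?D = "distr ?P borel vec_lambda :: (real ^ 'n) measure"
  let ?h = "\<lambda>z :: real ^ 'n. ennreal (1 / gauss_density z)"
  have [measurable_cong]: "sets ?P = sets (\<Pi>\<^sub>M i\<in>(UNIV :: 'n set). (borel :: real measure))"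
    by (intro sets_PiM_cong) simp_all
  have [measurable]: "vec_lambda \<in> borel_measurable ?P"
    by (rule measurable_vec_lambda) simp
  have "lborel = density ?D ?h"
  proof (rule lborel_eqI)
    fix l u :: "real ^ 'n" assume le: "\<And>b. b \<in> Basis \<Longrightarrow> l \<bullet> b \<le> u \<bullet> b"
    have le': "l $ i \<le> u $ i" for i
      using le[of "axis i 1"] by (simp add: inner_axis axis_in_Basis_iff)
    define w where "w i y = ennreal (1 / std_normal_density y) * indicator {l $ i <..< u $ i} y" for i and y :: real
    have [measurable]: "w i \<in> borel_measurable borel" for i
      unfolding w_def by measurable
    have pos: "0 < std_normal_density y" for y by (simp add: normal_density_pos)
    have int_w: "(\<integral>\<^sup>+y. w i y \<partial>std_normal_distribution) = ennreal (u $ i - l $ i)" for i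
    proof -
      have "(\<integral>\<^sup>+y. w i y \<partial>std_normal_distribution) = (\<integral>\<^sup>+y. ennreal (std_normal_density y) * w i y \<partial>lborel)"
        by (rule nn_integral_density) simp_all
      also have "\<dots> = (\<integral>\<^sup>+y. indicator {l $ i <..< u $ i} y \<partial>lborel)"
        using pos less_imp_neq[OF pos] by (intro nn_integral_cong)
           (auto simp: w_def ennreal_mult[symmetric] less_imp_le mult.assoc[symmetric])
      finally show ?thesis using le'[of i] by simp
    qed
    have "emeasure (density ?D ?h) (box l u) = (\<integral>\<^sup>+z. ?h z * indicator (box l u) z \<partial>?D)"
      by (rule emeasure_density) simp_all
    also have "\<dots> = (\<integral>\<^sup>+f. ?h (vec_lambda f) * indicator (box l u) (vec_lambda f) \<partial>?P)"
      by (rule nn_integral_distr) simp_all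
    also have "\<dots> = (\<integral>\<^sup>+f. (\<Prod>i\<in>UNIV. w i (f i)) \<partial>?P)"
    proof (intro nn_integral_cong)
      fix f :: "'n \<Rightarrow> real"
      have "indicator (box l u) (vec_lambda f) = (\<Prod>i\<in>UNIV. indicator {l $ i <..< u $ i} (f i) :: ennreal)"
        by (cases "vec_lambda f \<in> box l u") (auto simp: mem_box_cart prod_zero_iff indicator_eq_0_iff)
      moreover have "?h (vec_lambda f) = (\<Prod>i\<in>UNIV. ennreal (1 / std_normal_density (f i)))"
        by (subst prod_ennreal) (auto simp: gauss_density_prod prod_dividef)
      ultimately show "?h (vec_lambda f) * indicator (box l u) (vec_lambda f) = (\<Prod>i\<in>UNIV. w i (f i))"
        by (simp add: w_def prod.distrib)
    qed
    also have "\<dots> = (\<Prod>i\<in>UNIV. \<integral>\<^sup>+y. w i y \<partial>std_normal_distribution)"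
      by (rule P.product_nn_integral_prod) simp_all
    also have "\<dots> = (\<Prod>i\<in>UNIV. ennreal (u $ i - l $ i))"
      by (simp only: int_w)
    also have "\<dots> = ennreal (\<Prod>i\<in>UNIV. u $ i - l $ i)"
      using le' by (intro prod_ennreal) simp
    also have "(\<Prod>i\<in>UNIV. u $ i - l $ i) = (\<Prod>b\<in>Basis. (u - l) \<bullet> b)"
    proof -
      have Basis_eq: "(Basis :: (real ^ 'n) set) = (\<lambda>i. axis i 1) ` UNIV"
        by (auto simp: Basis_vec_def)
      have inj: "inj (\<lambda>i :: 'n. axis i (1 :: real))" by (auto simp: inj_def axis_eq_axis)
      have "(\<Prod>b\<in>Basis. (u - l) \<bullet> b) = (\<Prod>i\<in>UNIV. (u - l) \<bullet> axis i 1)"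
        unfolding Basis_eq by (subst prod.reindex[OF inj]) (simp add: o_def)
      then show ?thesis by (simp add: inner_axis)
    qed
    finally show "emeasure (density ?D ?h) (box l u) = (\<Prod>b\<in>Basis. (u - l) \<bullet> b)" .
  qed simp
  then have "gauss_measure = density (density ?D ?h) (\<lambda>z. ennreal (gauss_density z))"
    by (simp add: gauss_measure_def)
  also have "\<dots> = density ?D (\<lambda>z. ?h z * ennreal (gauss_density z))"
    by (rule density_density_eq) simp_all
  also have "(\<lambda>z :: real ^ 'n. ?h z * ennreal (gauss_density z)) = (\<lambda>_. 1)"
  proof
    fix z :: "real ^ 'n"
    have "?h z * ennreal (gauss_density z) = ennreal (1 / gauss_density z * gauss_density z)"
      using gauss_density_pos[of z] by (intro ennreal_mult[symmetric]) auto
    then show "?h z * ennreal (gauss_density z) = 1"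
      using gauss_density_pos[of z] by simp
  qed
  finally show ?thesis by (simp add: density_1)
qed

lemma prob_space_gauss_measure: "prob_space (gauss_measure :: (real ^ 'n) measure)"
proof -
  have "prob_space (\<Pi>\<^sub>M i\<in>(UNIV :: 'n set). std_normal_distribution)"
    by (intro prob_space_PiM) unfold_locales
  moreover have "vec_lambda \<in> borel_measurable (\<Pi>\<^sub>M i\<in>(UNIV :: 'n set). std_normal_distribution)"
    by (rule measurable_vec_lambda) simp
  ultimately show ?thesis
    unfolding gauss_measure_eq_distr by (rule prob_space.prob_space_distr)
qed

text \<open>Restricting to \<open>x < 0\<close> keeps \<open>\<Phi> x\<close> at most
  \<open>1 / 2\<close>, the range of \<open>half_line_crossing_prob_le\<close>; \<open>s\<close>
  selects the sign of the deviation.\<close>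

definition left_deviation :: "real \<Rightarrow> real \<Rightarrow> real ^ 'n \<Rightarrow> bool" where
  "left_deviation s v z \<longleftrightarrow> (\<exists>x<0. s * (empirical_cdf z x - \<Phi> x) > v)"

lemma empirical_deviation_right_continuous:
  fixes z :: "real ^ 'n"
  shows "((\<lambda>y. s * (empirical_cdf z y - \<Phi> y)) \<longlongrightarrow> s * (empirical_cdf z x - \<Phi> x)) (at_right x)"
proof -
  have "((\<lambda>y. indicator {..y} a :: real) \<longlongrightarrow> indicator {..x} a) (at_right x)" for a :: real
  proof (rule tendsto_eventually)
    show "eventually (\<lambda>y. indicator {..y} a = (indicator {..x} a :: real)) (at_right x)"
    proof (cases "a \<le> x")
      case True
      then show ?thesis
        by (intro eventually_mono[OF eventually_at_right_less[of x]]) (auto simp: indicator_def)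
    next
      case False
      then have "eventually (\<lambda>y. y < a) (at_right x)"
        by (auto intro!: eventually_at_right_real[THEN eventually_mono])
      then show ?thesis
        by eventually_elim (use False in \<open>auto simp: indicator_def\<close>)
    qed
  qed
  moreover have "(\<Phi> \<longlongrightarrow> \<Phi> x) (at_right x)"
    using isCont_\<Phi>[of x, unfolded isCont_def filterlim_at_split] by simp
  ultimately show ?thesis
    unfolding empirical_cdf_def by (intro tendsto_intros)
qed

text \<open>By right continuity a crossing point can be moved slightly to the right onto a negative
  rational. This yields measurability and the countable set of levels for the maximal
  inequality.\<close>

lemma left_deviation_rat:
  "left_deviation s v z \<longleftrightarrow> (\<exists>x\<in>{x\<in>\<rat>. x < 0}. s * (empirical_cdf z x - \<Phi> x) > v)"
proof
  assume "left_deviation s v z"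
  then obtain x where x: "x < 0" "s * (empirical_cdf z x - \<Phi> x) > v"
    by (auto simp: left_deviation_def)
  have "eventually (\<lambda>y. s * (empirical_cdf z y - \<Phi> y) > v) (at_right x)"
    using empirical_deviation_right_continuous x(2) by (rule order_tendstoD)
  then obtain b where b: "b > x" "\<And>y. x < y \<Longrightarrow> y < b \<Longrightarrow> s * (empirical_cdf z y - \<Phi> y) > v"
    by (auto simp: eventually_at_right_field)
  obtain r where "r \<in> \<rat>" "x < r" "r < min b 0"
    using Rats_dense_in_real[of x "min b 0"] x b by auto
  then show "\<exists>x\<in>{x\<in>\<rat>. x < 0}. s * (empirical_cdf z x - \<Phi> x) > v"
    using b by auto
qed (auto simp: left_deviation_def)

lemma countable_neg_rats: "countable {x\<in>\<rat>. x < (0::real)}"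
  by (rule countable_subset[OF _ countable_rat]) auto

lemma measurable_left_deviation [measurable]:
  "Measurable.pred borel (left_deviation s v :: real ^ 'n \<Rightarrow> bool)"
proof -
  note [simp] = countable_neg_rats
  have [measurable]: "(\<lambda>z :: real ^ 'n. empirical_cdf z x) \<in> borel_measurable borel" for x
    unfolding empirical_cdf_def by measurable
  show ?thesis
    unfolding left_deviation_rat[abs_def] by measurable
qed

lemma gauss_left_deviation_le:
  fixes s v :: real
  assumes "v > 0" "s \<in> {1, -1}"
  shows "measure gauss_measure {z :: real ^ 'n. left_deviation s v z}
    \<le> 4 * exp (- 2 * CARD('n) * v\<^sup>2 * (21 / 25)\<^sup>2)"
proof -
  let ?P = "\<Pi>\<^sub>M i\<in>(UNIV :: 'n set). std_normal_distribution"
  have "\<Phi> 0 = 1 / 2" using \<Phi>_minus[of 0] by simp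
  then have half: "\<Phi> x \<le> 1 / 2" if "x < 0" for x
    using gauss.cdf_nondecreasing[of x 0] that by simp
  have "vec_lambda \<in> borel_measurable ?P"
    by (rule measurable_vec_lambda) simp
  then have "measure gauss_measure {z :: real ^ 'n. left_deviation s v z} =
      measure ?P {f \<in> space ?P. left_deviation s v (vec_lambda f)}"
    unfolding gauss_measure_eq_distr
    by (subst measure_distr) (auto intro!: arg_cong[where f="measure ?P"])
  also have "{f \<in> space ?P. left_deviation s v (vec_lambda f)} = {f \<in> space ?P. \<exists>x\<in>{x\<in>\<rat>. x < 0}.
      s * ((\<Sum>i\<in>UNIV. indicator {..x} (f i)) - CARD('n) * \<Phi> x) > CARD('n) * v}"
    unfolding left_deviation_rat empirical_cdf_altdef
    by (simp add: field_simps)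
  also have "measure ?P \<dots> \<le> 4 * exp (- 2 * CARD('n) * v\<^sup>2 * (21 / 25)\<^sup>2)"
    by (rule gauss.half_line_crossing_prob_le) (use assms half isCont_\<Phi> countable_neg_rats in auto)
  finally show ?thesis .
qed

section \<open>Polar decomposition of the Gaussian measure\<close>

text \<open>Finite upper tails determine a law on the line, and the fundamental theorem of calculus
  computes those of \<open>h\<close>. \<open>M\<close> may be infinite: it will be Lebesgue measure
  on a cone or on the whole space. The minus signs in \<open>- ln (norm z)\<close> and
  \<open>- norm z\<close> turn upper tails into bounded sets of finite volume.\<close>

lemma distr_eq_density_tail:
  fixes W :: "'a \<Rightarrow> real" and H h :: "real \<Rightarrow> real"
  assumes [measurable]: "W \<in> borel_measurable M" "h \<in> borel_measurable borel"
    and tail: "\<And>x. emeasure M {z \<in> space M. x < W z} = ennreal (H x)"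
    and deriv: "\<And>x. (H has_real_derivative - h x) (at x)"
    and nonneg: "\<And>x. 0 \<le> h x" and lim: "(H \<longlongrightarrow> 0) at_top"
  shows "distr M borel W = density lborel h"
proof (rule measure_eqI_lessThan)
  fix x
  have eq: "emeasure (distr M borel W) {x<..} = ennreal (H x)"
    using tail[of x] by (simp add: emeasure_distr vimage_def Int_def conj_commute)
  show "emeasure (distr M borel W) {x<..} < \<infinity>"
    by (simp add: eq)
  have "emeasure (density lborel h) {x<..} = (\<integral>\<^sup>+y. ennreal (h y) * indicator {x<..} y \<partial>lborel)"
    by (simp add: emeasure_density)
  also have "\<dots> = (\<integral>\<^sup>+y. ennreal (h y) * indicator {x..} y \<partial>lborel)"
    using AE_lborel_singleton[of x]
    by (intro nn_integral_cong_AE) (auto split: split_indicator elim!: eventually_mono)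
  also have "\<dots> = ennreal (0 - (- H x))"
  proof (rule nn_integral_FTC_atLeast[where F="\<lambda>x. - H x"])
    show "((\<lambda>x. - H x) has_real_derivative h y) (at y)" for y
      using DERIV_minus[OF deriv[of y]] by simp
    show "((\<lambda>x. - H x) \<longlongrightarrow> 0) at_top" using tendsto_minus[OF lim] by simp
  qed (use nonneg in auto)
  finally show "emeasure (distr M borel W) {x<..} = emeasure (density lborel h) {x<..}"
    by (simp add: eq)
qed simp_all

lemma AE_lborel_norm_neq: "AE z in lborel. norm (z :: 'a::euclidean_space) \<noteq> r"
proof -
  have "sphere (0 :: 'a) r \<in> null_sets lebesgue"
    using negligible_sphere by (simp add: negligible_iff_null_sets)
  then have "sphere (0 :: 'a) r \<in> null_sets lborel"
    by (simp add: null_sets_completion_iff)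
  then show ?thesis
    by (rule AE_not_in[THEN AE_mp]) (auto intro: AE_I2)
qed

text \<open>Scaling by \<open>r\<close> reduces to the unit ball, where the cone over
  \<open>A\<close> is the set that defines \<open>uniform_sphere\<close>.\<close>

lemma emeasure_cone:
  fixes A :: "'a::euclidean_space set"
  assumes [measurable]: "A \<in> sets borel" and "0 < r"
  shows "emeasure lborel {z. sgn z \<in> A \<and> norm z < r}
    = ennreal (unit_ball_vol DIM('a) * r ^ DIM('a)) * emeasure uniform_sphere A"
proof -
  let ?C = "\<lambda>r. {z. sgn z \<in> A \<and> norm z < r}"
  have [measurable]: "?C r \<in> sets borel" for r by measurable
  have [measurable]: "sgn -` A \<in> sets borel"
    using measurable_sets[OF sgn_borel_measurable, of A] by simp
  have "emeasure lborel (?C r) = emeasure (density (distr lborel borel (\<lambda>x. 0 + r *\<^sub>R x)) (\<lambda>_. \<bar>r\<bar> ^ DIM('a))) (?C r)"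
    using lborel_affine[of r "0 :: 'a"] \<open>0 < r\<close> by (intro arg_cong2[where f=emeasure]) auto
  also have "\<dots> = ennreal (r ^ DIM('a)) * emeasure (distr lborel borel (\<lambda>x. r *\<^sub>R x)) (?C r)"
    using \<open>0 < r\<close> by (subst emeasure_density_const) auto
  also have "emeasure (distr lborel borel (\<lambda>x. r *\<^sub>R x)) (?C r) = emeasure lborel (?C 1)"
    using \<open>0 < r\<close> by (subst emeasure_distr) (auto simp: sgn_scaleR intro!: arg_cong2[where f=emeasure])
  \<comment> \<open>The open and the closed unit ball differ by a null sphere.\<close>
  also have "emeasure lborel (?C 1) = emeasure lborel (cball 0 1 \<inter> sgn -` A)"
    using AE_lborel_norm_neq[of 1] by (intro emeasure_eq_AE) (auto elim!: eventually_mono)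
  also have "\<dots> = emeasure lborel (cball 0 1 :: 'a set) * emeasure uniform_sphere A"
  proof -
    have "emeasure uniform_sphere A = emeasure lborel (cball 0 1 \<inter> sgn -` A) / emeasure lborel (cball 0 1 :: 'a set)"
      unfolding uniform_sphere_def by (simp add: emeasure_distr emeasure_uniform_measure)
    then show ?thesis
      using emeasure_unit_cball[where 'a='a]
      by (metis ennreal_mult_divide_eq ennreal_times_divide mult.commute infinity_ennreal_def)
  qed
  also have "emeasure lborel (cball 0 1 :: 'a set) = ennreal (unit_ball_vol DIM('a))"
    by (simp add: emeasure_cball)
  finally show ?thesis
    using \<open>0 < r\<close> by (simp add: ennreal_mult mult_ac)
qed

text \<open>Differentiating the cone volume in the radius. The logarithm turns the power of the
  radius into an exponential, smooth on the whole line in every dimension; the factor depending on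
  \<open>A\<close> splits off.\<close>

lemma distr_log_norm_cone:
  fixes A :: "'a::euclidean_space set"
  assumes [measurable]: "A \<in> sets borel"
  defines "n \<equiv> DIM('a)"
  shows "distr (density lborel (indicator (sgn -` A))) borel (\<lambda>z. - ln (norm z))
    = density lborel (\<lambda>w. ennreal (unit_ball_vol n * measure uniform_sphere A * n * exp (- real n * w)))"
proof (rule distr_eq_density_tail[where H="\<lambda>w. unit_ball_vol n * measure uniform_sphere A * exp (- real n * w)"])
  interpret S: prob_space "uniform_sphere :: 'a measure" by (rule prob_space_uniform_sphere)
  have [measurable]: "sgn -` A \<in> sets borel"
    using measurable_sets[OF sgn_borel_measurable, of A] by simp
  fix x :: real
  have "emeasure (density lborel (indicator (sgn -` A))) {z \<in> space (density lborel (indicator (sgn -` A))). x < - ln (norm z)}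
      = (\<integral>\<^sup>+z. indicator (sgn -` A) z * indicator {z. x < - ln (norm z)} z \<partial>lborel)"
    by (simp add: emeasure_density)
  also have "\<dots> = (\<integral>\<^sup>+z. indicator {z. sgn z \<in> A \<and> norm z < exp (- x)} z \<partial>lborel)"
  proof (intro nn_integral_cong_AE, rule eventually_mono[OF AE_lborel_singleton[of 0]])
    fix z :: 'a assume "z \<noteq> 0"
    then have "x < - ln (norm z) \<longleftrightarrow> norm z < exp (- x)"
      by (metis exp_less_cancel_iff exp_ln less_minus_iff zero_less_norm_iff)
    then show "indicator (sgn -` A) z * indicator {z. x < - ln (norm z)} z
        = (indicator {z. sgn z \<in> A \<and> norm z < exp (- x)} z :: ennreal)"
      by (auto split: split_indicator)
  qed
  also have "\<dots> = emeasure lborel {z. sgn z \<in> A \<and> norm z < exp (- x)}"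
    by (rule nn_integral_indicator) measurable
  also have "\<dots> = ennreal (unit_ball_vol n * measure uniform_sphere A * exp (- real n * x))"
    by (subst emeasure_cone) (simp_all add: S.emeasure_eq_measure n_def ennreal_mult mult_ac exp_of_nat_mult[symmetric])
  finally show "emeasure (density lborel (indicator (sgn -` A))) {z \<in> space (density lborel (indicator (sgn -` A))). x < - ln (norm z)}
    = ennreal (unit_ball_vol n * measure uniform_sphere A * exp (- real n * x))" .
  show "((\<lambda>w. unit_ball_vol n * measure uniform_sphere A * exp (- real n * w)) has_real_derivative
      - (unit_ball_vol n * measure uniform_sphere A * n * exp (- real n * x))) (at x)"
    by (auto intro!: derivative_eq_intros)
next
  have "filterlim (\<lambda>w. - real n * w) at_bot at_top"
    unfolding n_def using DIM_positive[where 'a='a] by real_asymp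
  from filterlim_compose[OF exp_at_bot this]
  have "((\<lambda>w. exp (- real n * w)) \<longlongrightarrow> 0) at_top" .
  from tendsto_mult_right_zero[OF this]
  show "((\<lambda>w. unit_ball_vol n * measure uniform_sphere A * exp (- real n * w)) \<longlongrightarrow> 0) at_top" .
qed simp_all

text \<open>A second radial variable, whose Gaussian density peaks at \<open>- sqrt (n - 1)\<close>.
  Its tail has a possible kink at \<open>0\<close>, which is differentiable from dimension two
  on.\<close>

lemma distr_neg_norm:
  assumes "2 \<le> DIM('a::euclidean_space)"
  defines "n \<equiv> DIM('a)"
  shows "distr (lborel :: 'a measure) borel (\<lambda>z. - norm z)
    = density lborel (\<lambda>w. ennreal (unit_ball_vol n * n * max 0 (- w) ^ (n - 1)))"
proof (rule distr_eq_density_tail[where H="\<lambda>w. unit_ball_vol n * max 0 (- w) ^ n"])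
  fix x :: real
  have "{z \<in> space lborel. x < - norm z} = ball (0 :: 'a) (max 0 (- x))"
    by (auto simp: max_def split: if_splits) (smt (verit) norm_ge_zero)+
  then show "emeasure (lborel :: 'a measure) {z \<in> space lborel. x < - norm z} = ennreal (unit_ball_vol n * max 0 (- x) ^ n)"
    by (simp add: emeasure_ball n_def)
  have *: "((\<lambda>w. max 0 (- w) ^ n) has_real_derivative - (n * max 0 (- x) ^ (n - 1))) (at x)"
  proof (rule linorder_cases[of x 0])
    assume "x < 0"
    have "((\<lambda>w. (- w) ^ n) has_real_derivative - (n * max 0 (- x) ^ (n - 1))) (at x)"
      using \<open>x < 0\<close> by (auto intro!: derivative_eq_intros)
    moreover have ev: "eventually (\<lambda>w. (- w) ^ n = max 0 (- w) ^ n) (nhds x)"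
      using eventually_nhds_in_open[of "{..<0}" x] \<open>x < 0\<close> by (auto elim!: eventually_mono simp: max_def)
    ultimately show ?thesis
      using DERIV_cong_ev[OF refl ev refl] by (simp only:)
  next
    assume "0 < x"
    have "((\<lambda>w. 0) has_real_derivative - (n * max 0 (- x) ^ (n - 1))) (at x)"
      using \<open>0 < x\<close> assms by (auto intro!: derivative_eq_intros simp: max_def)
    moreover have ev: "eventually (\<lambda>w. 0 = max 0 (- w) ^ n) (nhds x)"
      using eventually_nhds_in_open[of "{0<..}" x] \<open>0 < x\<close> assms
      by (auto elim!: eventually_mono simp: max_def)
    ultimately show ?thesis
      using DERIV_cong_ev[OF refl ev refl] by (simp only:)
  next
    assume "x = 0"
    \<comment> \<open>At the kink the difference quotient is at most
      \<open>\<bar>h\<bar> ^ (n - 1)\<close>, which vanishes in the limit since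
      \<open>n \<ge> 2\<close>.\<close>
    have "((\<lambda>h. max 0 (- h) ^ n / h) \<longlongrightarrow> (0 :: real)) (at 0)"
    proof (rule Lim_null_comparison)
      show "((\<lambda>h. \<bar>h\<bar> ^ (n - 1)) \<longlongrightarrow> (0 :: real)) (at 0)"
        using assms by (auto intro!: tendsto_eq_intros)
      show "eventually (\<lambda>h. norm (max 0 (- h) ^ n / h) \<le> \<bar>h\<bar> ^ (n - 1)) (at (0 :: real))"
      proof (rule eventually_mono[OF eventually_neq_at_within])
        fix h :: real assume "h \<noteq> 0"
        have "max 0 (- h) ^ n \<le> \<bar>h\<bar> ^ n" by (intro power_mono) auto
        also have "\<bar>h\<bar> ^ n = \<bar>h\<bar> ^ (n - 1) * \<bar>h\<bar>"
          using assms by (metis n_def DIM_positive power_minus_mult)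
        finally show "norm (max 0 (- h) ^ n / h) \<le> \<bar>h\<bar> ^ (n - 1)"
          using \<open>h \<noteq> 0\<close> by (simp add: abs_mult divide_le_eq)
      qed
    qed
    then show ?thesis
      using assms \<open>x = 0\<close> by (simp add: DERIV_def power_0_left)
  qed
  show "((\<lambda>w. unit_ball_vol n * max 0 (- w) ^ n) has_real_derivative
      - (unit_ball_vol n * n * max 0 (- x) ^ (n - 1))) (at x)"
    using DERIV_cmult[OF *, of "unit_ball_vol n"] by (simp add: mult_ac)
next
  have "eventually (\<lambda>w. unit_ball_vol n * max 0 (- w) ^ n = 0) at_top"
    using eventually_ge_at_top[of 0] by eventually_elim (use assms in \<open>auto simp: max_def\<close>)
  then show "((\<lambda>w. unit_ball_vol n * max 0 (- w) ^ n) \<longlongrightarrow> 0) at_top"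
    by (rule tendsto_eventually)
qed (simp_all add: n_def)

text \<open>Reflection at \<open>w0\<close> maps one half line onto the other; \<open>c\<close>
  selects the heavier side. With \<open>w0\<close> the mode of a radial density this yields
  probability at least \<open>1 / 2\<close> on that side.\<close>

lemma nn_integral_reflect_le:
  fixes k :: "real \<Rightarrow> ennreal" and c w0 :: real
  assumes [measurable]: "k \<in> borel_measurable borel" and "c \<in> {1, -1}"
    and le: "\<And>y. 0 < y \<Longrightarrow> k (w0 - c * y) \<le> k (w0 + c * y)"
  shows "(\<integral>\<^sup>+w. k w * indicator {w. c * (w - w0) < 0} w \<partial>lborel)
    \<le> (\<integral>\<^sup>+w. k w * indicator {w. 0 \<le> c * (w - w0)} w \<partial>lborel)"
proof -
  have "(\<integral>\<^sup>+w. k w * indicator {w. c * (w - w0) < 0} w \<partial>lborel)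
      = (\<integral>\<^sup>+w. k (2 * w0 + (- 1) * w) * indicator {w. c * (w - w0) < 0} (2 * w0 + (- 1) * w) \<partial>lborel)"
    by (subst nn_integral_real_affine[where c="-1" and t="2 * w0"]) auto
  also have "\<dots> \<le> (\<integral>\<^sup>+w. k w * indicator {w. 0 \<le> c * (w - w0)} w \<partial>lborel)"
  proof (intro nn_integral_mono)
    fix w :: real
    show "k (2 * w0 + (- 1) * w) * indicator {w. c * (w - w0) < 0} (2 * w0 + (- 1) * w)
      \<le> k w * indicator {w. 0 \<le> c * (w - w0)} w"
      using le[of "c * (w - w0)"] \<open>c \<in> {1, -1}\<close> by (auto split: split_indicator)
  qed
  finally show ?thesis .
qed


text \<open>\<open>gauss_density\<close> depends on the norm alone, so integrating over the cone
  over \<open>A\<close> leaves the mass of \<open>A\<close> times a one-dimensional integral;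
  \<open>k\<close> is the density of \<open>- ln (norm z)\<close>.\<close>

lemma emeasure_gauss_cone:
  fixes A :: "(real ^ 'n) set" and B :: "real set"
  assumes [measurable]: "A \<in> sets borel" "B \<in> sets borel"
  defines "n \<equiv> CARD('n)"
  defines "k \<equiv> \<lambda>w. ennreal (unit_ball_vol n * n * (1 / sqrt (2 * pi)) ^ n * exp (- real n * w - exp (- 2 * w) / 2))"
  shows "emeasure gauss_measure {z. sgn z \<in> A \<and> - ln (norm z) \<in> B}
    = emeasure uniform_sphere A * (\<integral>\<^sup>+w. k w * indicator B w \<partial>lborel)"
proof -
  interpret S: prob_space "uniform_sphere :: (real ^ 'n) measure" by (rule prob_space_uniform_sphere)
  have [measurable]: "sgn -` A \<in> sets borel"
    using measurable_sets[OF sgn_borel_measurable, of A] by simp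
  define g where "g = (\<lambda>w. (1 / sqrt (2 * pi)) ^ n * exp (- exp (- 2 * w) / 2))"
  have "emeasure gauss_measure {z. sgn z \<in> A \<and> - ln (norm z) \<in> B}
      = (\<integral>\<^sup>+z. ennreal (gauss_density z) * indicator {z. sgn z \<in> A \<and> - ln (norm z) \<in> B} z \<partial>lborel)"
    unfolding gauss_measure_def by (rule emeasure_density) measurable
  also have "\<dots> = (\<integral>\<^sup>+z. indicator (sgn -` A) z * (ennreal (g (- ln (norm z))) * indicator B (- ln (norm z))) \<partial>lborel)"
  proof (intro nn_integral_cong_AE, rule eventually_mono[OF AE_lborel_singleton[of 0]])
    fix z :: "real ^ 'n" assume "z \<noteq> 0"
    then have "exp (- 2 * (- ln (norm z))) = (norm z)\<^sup>2"
      using exp_of_nat_mult[of 2 "ln (norm z)"] by simp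
    then have "g (- ln (norm z)) = gauss_density z"
      by (simp add: g_def gauss_density_def n_def)
    then show "ennreal (gauss_density z) * indicator {z. sgn z \<in> A \<and> - ln (norm z) \<in> B} z
        = indicator (sgn -` A) z * (ennreal (g (- ln (norm z))) * indicator B (- ln (norm z)))"
      by (auto split: split_indicator)
  qed
  also have "\<dots> = (\<integral>\<^sup>+z. ennreal (g (- ln (norm z))) * indicator B (- ln (norm z)) \<partial>density lborel (indicator (sgn -` A)))"
    unfolding g_def by (intro nn_integral_density[symmetric]) measurable
  also have "\<dots> = (\<integral>\<^sup>+w. ennreal (g w) * indicator B w \<partial>distr (density lborel (indicator (sgn -` A))) borel (\<lambda>z. - ln (norm z)))"
    unfolding g_def by (intro nn_integral_distr[symmetric]) measurable
  also have "\<dots> = (\<integral>\<^sup>+w. ennreal (unit_ball_vol n * measure uniform_sphere A * n * exp (- real n * w)) * (ennreal (g w) * indicator B w) \<partial>lborel)"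
    unfolding distr_log_norm_cone[OF assms(1)] g_def n_def
    by (subst nn_integral_density) (simp_all, measurable)
  also have "\<dots> = (\<integral>\<^sup>+w. ennreal (measure uniform_sphere A) * (k w * indicator B w) \<partial>lborel)"
  proof (intro nn_integral_cong)
    fix w :: real
    have "ennreal (unit_ball_vol n * measure uniform_sphere A * n * exp (- real n * w)) * ennreal (g w)
      = ennreal (unit_ball_vol n * measure uniform_sphere A * n * exp (- real n * w) * g w)"
      by (rule ennreal_mult'[symmetric]) (simp add: g_def)
    also have "\<dots> = ennreal (measure uniform_sphere A * (unit_ball_vol n * n * (1 / sqrt (2 * pi)) ^ n * exp (- real n * w - exp (- 2 * w) / 2)))"
    proof -
      have "exp (- real n * w - exp (- 2 * w) / 2) = exp (- real n * w) * exp (- exp (- 2 * w) / 2)"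
        by (simp flip: exp_add)
      then show ?thesis by (simp only: g_def mult_ac)
    qed
    also have "\<dots> = ennreal (measure uniform_sphere A) * k w"
      unfolding k_def by (rule ennreal_mult') simp
    finally show "ennreal (unit_ball_vol n * measure uniform_sphere A * n * exp (- real n * w)) * (ennreal (g w) * indicator B w)
        = ennreal (measure uniform_sphere A) * (k w * indicator B w)"
      by (simp add: mult.assoc[symmetric])
  qed
  also have "\<dots> = emeasure uniform_sphere A * (\<integral>\<^sup>+w. k w * indicator B w \<partial>lborel)"
    unfolding k_def S.emeasure_eq_measure by (rule nn_integral_cmult) measurable
  finally show ?thesis .
qed

lemma emeasure_gauss_log_norm:
  fixes B :: "real set"
  assumes "B \<in> sets borel"
  shows "emeasure gauss_measure {z :: real ^ 'n. - ln (norm z) \<in> B}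
    = (\<integral>\<^sup>+w. ennreal (unit_ball_vol CARD('n) * CARD('n) * (1 / sqrt (2 * pi)) ^ CARD('n) *
         exp (- real CARD('n) * w - exp (- 2 * w) / 2)) * indicator B w \<partial>lborel)"
  using emeasure_gauss_cone[of "UNIV :: (real ^ 'n) set" B] assms
    prob_space.emeasure_space_1[OF prob_space_uniform_sphere[where 'a="real ^ 'n"]]
  by (simp add: uniform_sphere_def)

lemma AE_gauss_measure_nonzero: "AE z in gauss_measure. (z :: real ^ 'n) \<noteq> 0"
  unfolding gauss_measure_def using AE_lborel_singleton[of "0 :: real ^ 'n"]
  by (subst AE_density) (auto elim!: eventually_mono)

text \<open>The factorisation of \<open>emeasure_gauss_cone\<close>, with \<open>B\<close> pulled
  back to the logarithmic variable. At the origin \<open>ln\<close> does not invert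
  \<open>exp\<close>, but that point is null.\<close>

lemma gauss_direction_norm_indep:
  fixes A :: "(real ^ 'n) set" and B :: "real set"
  assumes [measurable]: "A \<in> sets borel" "B \<in> sets borel"
  shows "measure gauss_measure {z. sgn z \<in> A \<and> norm z \<in> B}
    = measure uniform_sphere A * measure gauss_measure {z :: real ^ 'n. norm z \<in> B}"
proof -
  define B' where "B' = {w. exp (- w) \<in> B}"
  have [measurable]: "B' \<in> sets borel" unfolding B'_def by measurable
  have norm_eq: "norm z \<in> B \<longleftrightarrow> - ln (norm z) \<in> B'" if "z \<noteq> 0" for z :: "real ^ 'n"
    using that by (simp add: B'_def)
  have "emeasure gauss_measure {z. sgn z \<in> A \<and> norm z \<in> B}
      = emeasure gauss_measure {z. sgn z \<in> A \<and> - ln (norm z) \<in> B'}"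
    using AE_gauss_measure_nonzero by (intro emeasure_eq_AE) (auto elim!: eventually_mono simp: norm_eq)
  also have "\<dots> = emeasure uniform_sphere A * emeasure gauss_measure {z :: real ^ 'n. - ln (norm z) \<in> B'}"
    by (simp only: emeasure_gauss_cone[OF assms(1) \<open>B' \<in> sets borel\<close>] emeasure_gauss_log_norm[OF \<open>B' \<in> sets borel\<close>])
  also have "emeasure gauss_measure {z :: real ^ 'n. - ln (norm z) \<in> B'} = emeasure gauss_measure {z :: real ^ 'n. norm z \<in> B}"
    using AE_gauss_measure_nonzero by (intro emeasure_eq_AE) (auto elim!: eventually_mono simp: norm_eq)
  finally show ?thesis by (simp add: measure_def enn2real_mult)
qed

section \<open>Bounds on the median of the Gaussian norm\<close>

lemma half_le_measure_if_compl_le: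
  assumes "prob_space M" "{z \<in> space M. P z} \<in> sets M"
    and "emeasure M {z \<in> space M. \<not> P z} \<le> emeasure M {z \<in> space M. P z}"
  shows "1 / 2 \<le> measure M {z \<in> space M. P z}"
proof -
  interpret prob_space M by fact
  have "measure M {z \<in> space M. \<not> P z} \<le> measure M {z \<in> space M. P z}"
    using assms(3) by (simp add: emeasure_eq_measure)
  then show ?thesis
    using prob_neg[OF assms(2)] by simp
qed

text \<open>This is \<open>sinh y \<ge> y\<close>, doubled; the derivative of the difference is a
  square times a positive factor.\<close>

lemma le_sinh_real: "0 \<le> y \<Longrightarrow> 2 * y \<le> exp y - exp (- y :: real)"
proof -
  assume "0 \<le> y"
  have "(\<lambda>y. exp y - exp (- y) - 2 * y) 0 \<le> (\<lambda>y. exp y - exp (- y) - 2 * y) y"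
  proof (rule DERIV_nonneg_imp_nondecreasing[OF \<open>0 \<le> y\<close>], intro exI conjI)
    fix x :: real
    show "((\<lambda>y. exp y - exp (- y) - 2 * y) has_real_derivative exp x + exp (- x) - 2) (at x)"
      by (auto intro!: derivative_eq_intros)
    have "(exp x - 1)\<^sup>2 * exp (- x) \<ge> 0" by simp
    also have "(exp x - 1)\<^sup>2 * exp (- x) = exp x + exp (- x) - 2"
      by (simp add: power2_eq_square algebra_simps flip: exp_add)
    finally show "exp x + exp (- x) - 2 \<ge> 0" .
  qed
  then show ?thesis by simp
qed

text \<open>The left side is the first term of the series of \<open>2 * artanh s\<close>. It serves
  both the reflection of \<open>- norm z\<close> and the rational bounds on \<open>exp\<close>
  below.\<close>

lemma le_artanh_real:
  assumes "0 \<le> s" "s < (1 :: real)"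
  shows "2 * s \<le> ln (1 + s) - ln (1 - s)"
proof -
  have "(\<lambda>s. ln (1 + s) - ln (1 - s) - 2 * s) 0 \<le> (\<lambda>s. ln (1 + s) - ln (1 - s) - 2 * s) s"
  proof (rule DERIV_nonneg_imp_nondecreasing[OF \<open>0 \<le> s\<close>], intro exI conjI)
    fix x :: real assume x: "0 \<le> x" "x \<le> s"
    show "((\<lambda>s. ln (1 + s) - ln (1 - s) - 2 * s) has_real_derivative 1 / (1 + x) + 1 / (1 - x) - 2) (at x)"
      using x assms by (auto intro!: derivative_eq_intros)
    have "x * x < 1" using mult_strict_mono[of x 1 x 1] x assms by auto
    moreover have "1 / (1 + x) + 1 / (1 - x) = 2 / (1 - x * x)"
      using x assms by (simp add: field_simps)
    ultimately show "1 / (1 + x) + 1 / (1 - x) - 2 \<ge> 0"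
      by (simp add: le_divide_eq)
  qed
  then show ?thesis by simp
qed

text \<open>
  The density of \<open>- ln (norm z)\<close> has its mode at \<open>- ln (sqrt n)\<close>, and reflection at the mode
  compares its two halves pointwise. For \<open>- norm z\<close> the mode is \<open>- sqrt (n - 1)\<close>, and the
  comparison goes the other way.
\<close>

lemma gauss_norm_le_sqrt:
  "1 / 2 \<le> measure gauss_measure {z :: real ^ 'n. norm z \<le> sqrt CARD('n)}"
proof -
  define n where "n = CARD('n)"
  have n: "n > 0" by (simp add: n_def)
  define w0 where "w0 = - ln (sqrt n)"
  define k where "k = (\<lambda>w. ennreal (unit_ball_vol n * n * (1 / sqrt (2 * pi)) ^ n * exp (- real n * w - exp (- 2 * w) / 2)))"
  have w0: "exp (- 2 * w0) = n"
    using exp_of_nat_mult[of 2 "ln (sqrt n)"] n by (simp add: w0_def)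
  have "emeasure gauss_measure {z :: real ^ 'n. \<not> w0 \<le> - ln (norm z)}
      = (\<integral>\<^sup>+w. k w * indicator {w. 1 * (w - w0) < 0} w \<partial>lborel)"
    using emeasure_gauss_log_norm[of "{..<w0}", where 'n='n]
    by (simp add: k_def n_def not_le lessThan_def)
  also have "\<dots> \<le> (\<integral>\<^sup>+w. k w * indicator {w. 0 \<le> 1 * (w - w0)} w \<partial>lborel)"
  proof (rule nn_integral_reflect_le)
    fix y :: real assume "0 < y"
    have e: "exp (- 2 * (w0 + a)) = n * exp (- 2 * a)" for a
      unfolding w0[symmetric] exp_add[symmetric] by (simp add: algebra_simps)
    \<comment> \<open>The exponents at \<open>w0 + y\<close> and \<open>w0 - y\<close> differ by
      \<open>n * (sinh (2 * y) - 2 * y)\<close>.\<close>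
    have "n * (2 * (2 * y)) \<le> n * (exp (2 * y) - exp (- (2 * y)))"
      using le_sinh_real[of "2 * y"] \<open>0 < y\<close> by (intro mult_left_mono) auto
    then have "- real n * (w0 - y) - exp (- 2 * (w0 - y)) / 2 \<le> - real n * (w0 + y) - exp (- 2 * (w0 + y)) / 2"
      using e[of y] e[of "- y"] by (simp add: algebra_simps)
    then show "k (w0 - 1 * y) \<le> k (w0 + 1 * y)"
      unfolding k_def by (intro ennreal_leI mult_left_mono) auto
  qed (auto simp: k_def)
  also have "\<dots> = emeasure gauss_measure {z :: real ^ 'n. w0 \<le> - ln (norm z)}"
    using emeasure_gauss_log_norm[of "{w0..}", where 'n='n]
    by (simp add: k_def n_def atLeast_def)
  finally have "1 / 2 \<le> measure gauss_measure {z :: real ^ 'n. w0 \<le> - ln (norm z)}"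
    using half_le_measure_if_compl_le[OF prob_space_gauss_measure[where 'n='n], of "\<lambda>z. w0 \<le> - ln (norm z)"]
    by simp
  also have "\<dots> = measure gauss_measure {z :: real ^ 'n. norm z \<le> sqrt CARD('n)}"
  proof -
    have "w0 \<le> - ln (norm z) \<longleftrightarrow> norm z \<le> sqrt CARD('n)" if "z \<noteq> 0" for z :: "real ^ 'n"
      using that n by (simp add: w0_def n_def)
    then show ?thesis
      using AE_gauss_measure_nonzero unfolding measure_def
      by (intro arg_cong[where f=enn2real] emeasure_eq_AE) (auto elim!: eventually_mono)
  qed
  finally show ?thesis .
qed

lemma emeasure_gauss_neg_norm:
  fixes B :: "real set"
  assumes "2 \<le> CARD('n)" and [measurable]: "B \<in> sets borel"
  shows "emeasure gauss_measure {z :: real ^ 'n. - norm z \<in> B}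
    = (\<integral>\<^sup>+w. ennreal (unit_ball_vol CARD('n) * CARD('n) * max 0 (- w) ^ (CARD('n) - 1) *
         ((1 / sqrt (2 * pi)) ^ CARD('n) * exp (- w\<^sup>2 / 2))) * indicator B w \<partial>lborel)"
proof -
  define g where "g = (\<lambda>w. (1 / sqrt (2 * pi)) ^ CARD('n) * exp (- w\<^sup>2 / 2))"
  have "emeasure gauss_measure {z :: real ^ 'n. - norm z \<in> B}
      = (\<integral>\<^sup>+z. ennreal (g (- norm z)) * indicator B (- norm z) \<partial>(lborel :: (real ^ 'n) measure))"
    unfolding gauss_measure_def
    by (subst emeasure_density) (auto simp: g_def gauss_density_def intro!: nn_integral_cong split: split_indicator)
  also have "\<dots> = (\<integral>\<^sup>+w. ennreal (g w) * indicator B w \<partial>distr (lborel :: (real ^ 'n) measure) borel (\<lambda>z. - norm z))"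
    unfolding g_def by (intro nn_integral_distr[symmetric]) measurable
  also have "\<dots> = (\<integral>\<^sup>+w. ennreal (unit_ball_vol CARD('n) * CARD('n) * max 0 (- w) ^ (CARD('n) - 1)) * (ennreal (g w) * indicator B w) \<partial>lborel)"
    using assms(1) unfolding g_def
    by (subst distr_neg_norm) (simp, subst nn_integral_density, simp_all)
  also have "\<dots> = (\<integral>\<^sup>+w. ennreal (unit_ball_vol CARD('n) * CARD('n) * max 0 (- w) ^ (CARD('n) - 1) * g w) * indicator B w \<partial>lborel)"
    by (simp add: g_def ennreal_mult'[symmetric] mult.assoc[symmetric])
  finally show ?thesis unfolding g_def .
qed

lemma gauss_norm_ge_sqrt:
  assumes "2 \<le> CARD('n)"
  shows "1 / 2 \<le> measure gauss_measure {z :: real ^ 'n. sqrt (real CARD('n) - 1) \<le> norm z}"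
proof -
  define n where "n = CARD('n)"
  have n: "n \<ge> 2" using assms by (simp add: n_def)
  define m where "m = sqrt (real n - 1)"
  have m: "m > 0" "m\<^sup>2 = real n - 1" using n by (auto simp: m_def)
  define k where "k = (\<lambda>w. ennreal (unit_ball_vol n * n * max 0 (- w) ^ (n - 1) * ((1 / sqrt (2 * pi)) ^ n * exp (- w\<^sup>2 / 2))))"
  have sets: "{w. (- 1) * (w - (- m)) < 0} = {- m<..}" "{w. 0 \<le> (- 1) * (w - (- m))} = {..- m}"
    "{z :: real ^ 'n. \<not> - norm z \<le> - m} = {z. - norm z \<in> {- m<..}}"
    "{z :: real ^ 'n. - norm z \<le> - m} = {z. - norm z \<in> {..- m}}"
    by auto
  have "emeasure gauss_measure {z :: real ^ 'n. \<not> - norm z \<le> - m}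
      = (\<integral>\<^sup>+w. k w * indicator {w. (- 1) * (w - (- m)) < 0} w \<partial>lborel)"
    using emeasure_gauss_neg_norm[OF assms, of "{- m<..}"]
    unfolding k_def n_def sets by simp
  also have "\<dots> \<le> (\<integral>\<^sup>+w. k w * indicator {w. 0 \<le> (- 1) * (w - (- m))} w \<partial>lborel)"
  proof (rule nn_integral_reflect_le)
    fix y :: real assume y: "0 < y"
    have "max 0 (m - y) ^ (n - 1) * exp (- (m - y)\<^sup>2 / 2) \<le> max 0 (m + y) ^ (n - 1) * exp (- (m + y)\<^sup>2 / 2)"
    proof (cases "y < m")
      case True
      have eq: "max 0 a ^ (n - 1) * exp (- a\<^sup>2 / 2) = exp (m\<^sup>2 * ln a - a\<^sup>2 / 2)" if "0 < a" for a
      proof -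
        have "m\<^sup>2 = real (n - 1)" using m n by simp
        then have "exp (m\<^sup>2 * ln a) = a ^ (n - 1)"
          using that exp_of_nat_mult[of "n - 1" "ln a"] by simp
        moreover have "exp (m\<^sup>2 * ln a - a\<^sup>2 / 2) = exp (m\<^sup>2 * ln a) * exp (- a\<^sup>2 / 2)"
          by (simp flip: exp_add)
        ultimately show ?thesis using that by simp
      qed
      \<comment> \<open>After taking logarithms, with \<open>n - 1 = m\<^sup>2\<close>, the claim
        reads \<open>2 * m * y \<le> m\<^sup>2 * (ln (m + y) - ln (m - y))\<close>.\<close>
      have "2 * (y / m) \<le> ln (1 + y / m) - ln (1 - y / m)"
        using y m True by (intro le_artanh_real) auto
      also have "\<dots> = ln (m * (1 + y / m)) - ln (m * (1 - y / m))"
      proof -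
        have "0 < 1 + y / m" "0 < 1 - y / m" using y m True by (auto intro: add_pos_pos)
        then show ?thesis using m by (simp add: ln_mult)
      qed
      also have "m * (1 + y / m) = m + y" using m by (simp add: field_simps)
      also have "m * (1 - y / m) = m - y" using m by (simp add: field_simps)
      finally have "m\<^sup>2 * (2 * (y / m)) \<le> m\<^sup>2 * (ln (m + y) - ln (m - y))"
        by (intro mult_left_mono) auto
      moreover have "m\<^sup>2 * (2 * (y / m)) = 2 * m * y" using m(1) by (simp add: power2_eq_square)
      ultimately have "2 * m * y \<le> m\<^sup>2 * ln (m + y) - m\<^sup>2 * ln (m - y)"
        by (simp only: right_diff_distrib)
      moreover have "(m + y)\<^sup>2 / 2 = (m - y)\<^sup>2 / 2 + 2 * m * y"
        by (simp add: power2_sum power2_diff field_simps)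
      ultimately have "m\<^sup>2 * ln (m - y) - (m - y)\<^sup>2 / 2 \<le> m\<^sup>2 * ln (m + y) - (m + y)\<^sup>2 / 2"
        by linarith
      then show ?thesis using True y m by (simp only: eq) simp
    next
      case False
      \<comment> \<open>The reflected point corresponds to a nonpositive norm, where the density
        vanishes.\<close>
      then have "max 0 (m - y) ^ (n - 1) = 0" using n by (simp add: max_def power_0_left)
      then show ?thesis by (simp only: mult_zero_left) (intro mult_nonneg_nonneg zero_le_power; simp)
    qed
    then have "(unit_ball_vol n * n * (1 / sqrt (2 * pi)) ^ n) * (max 0 (m - y) ^ (n - 1) * exp (- (m - y)\<^sup>2 / 2))
        \<le> (unit_ball_vol n * n * (1 / sqrt (2 * pi)) ^ n) * (max 0 (m + y) ^ (n - 1) * exp (- (m + y)\<^sup>2 / 2))"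
      by (intro mult_left_mono) auto
    moreover have "(- m + y)\<^sup>2 = (m - y)\<^sup>2" "(- m - y)\<^sup>2 = (m + y)\<^sup>2"
      by (simp_all add: power2_eq_square algebra_simps)
    ultimately show "k (- m - (- 1) * y) \<le> k (- m + (- 1) * y)"
      unfolding k_def by (intro ennreal_leI) (simp add: ac_simps)
  qed (auto simp: k_def)
  also have "\<dots> = emeasure gauss_measure {z :: real ^ 'n. - norm z \<le> - m}"
    using emeasure_gauss_neg_norm[OF assms, of "{..- m}"]
    unfolding k_def n_def sets by simp
  finally have "1 / 2 \<le> measure gauss_measure {z :: real ^ 'n. - norm z \<le> - m}"
    using half_le_measure_if_compl_le[OF prob_space_gauss_measure[where 'n='n], of "\<lambda>z. - norm z \<le> - m"]
    by simp
  then show ?thesis by (simp add: m_def n_def)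
qed

section \<open>Numerical bounds\<close>

text \<open>\<open>(1 - s) / (1 + s)\<close> is the Pade approximant of
  \<open>exp (- (2 * s))\<close>; its powers give good rational lower bounds with few
  factors.\<close>

lemma exp_minus_power_ge:
  fixes s :: real and n :: nat
  assumes "0 \<le> s" "s < 1"
  shows "((1 - s) / (1 + s)) ^ n \<le> exp (- (2 * s * n))"
proof -
  have "ln ((1 - s) / (1 + s)) \<le> - (2 * s)"
    using le_artanh_real[OF assms] assms by (simp add: ln_div)
  then have "(1 - s) / (1 + s) \<le> exp (- (2 * s))"
    using assms by (metis add_pos_nonneg diff_gt_0_iff_gt divide_pos_pos exp_le_cancel_iff exp_ln zero_less_one)
  then have "((1 - s) / (1 + s)) ^ n \<le> exp (- (2 * s)) ^ n"
    using assms by (intro power_mono) auto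
  then show ?thesis by (simp add: exp_of_nat_mult[symmetric] mult_ac)
qed

text \<open>A tangent to the convex function \<open>exp (- x)\<close> at \<open>x0\<close>, with a
  rational \<open>c\<close> for the unknown value there and an upper bound \<open>X\<close> for
  \<open>x\<close>.\<close>

lemma exp_minus_tangent:
  fixes x x0 c :: real
  assumes "c \<le> exp (- x0)" "0 \<le> c" "x \<le> X"
  shows "c * (1 + x0 - X) \<le> exp (- x)"
proof (cases "0 \<le> 1 + x0 - X")
  case True
  have "c * (1 + x0 - X) \<le> exp (- x0) * (1 + (x0 - X))"
    using assms True by (simp add: mult_right_mono add_diff_eq)
  also have "\<dots> \<le> exp (- x0) * exp (x0 - X)"
    by (intro mult_left_mono exp_ge_add_one_self) auto
  also have "\<dots> \<le> exp (- x)" using assms by (simp flip: exp_add)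
  finally show ?thesis .
next
  case False
  then have "c * (1 + x0 - X) \<le> 0" using assms by (intro mult_nonneg_nonpos) auto
  then show ?thesis using exp_ge_zero[of "- x"] by linarith
qed

text \<open>Bounding \<open>a\<close> by \<open>9 / 5 - b / 2\<close> leaves one variable. On each
  longer piece, tangents to the exponentials and a chord for \<open>b\<^sup>2\<close> reduce the
  claim to a linear inequality in \<open>b\<close>.\<close>

lemma tail_bound_trivial_range:
  fixes a b :: real
  assumes "0 \<le> a" "0 \<le> b" "a + b / 2 \<le> 9 / 5"
  shows "1 \<le> 2 * exp (- (2 * a\<^sup>2)) + exp (- (9 / 64 * b\<^sup>2)) + exp (- b\<^sup>2)"
proof -
  define p where "p = b\<^sup>2"
  define A B C where "A = exp (- (2 * a\<^sup>2))" and "B = exp (- (9 / 64 * p))" and "C = exp (- p)"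
  note defs = A_def B_def C_def
  have "0 \<le> A" "0 \<le> C" by (simp_all add: defs)
  have "a\<^sup>2 \<le> (9 / 5 - b / 2)\<^sup>2" using assms by (intro power_mono) auto
  then have a2: "2 * a\<^sup>2 \<le> 162 / 25 - 18 / 5 * b + p / 2"
    by (simp add: p_def power2_diff power_divide)
  consider "b \<le> 5 / 4" | "5 / 4 \<le> b" "b \<le> 19 / 10" | "19 / 10 \<le> b" "b \<le> 18 / 5"
    using assms by linarith
  then have "1 \<le> 2 * A + B + C"
  proof cases
    case 1
    \<comment> \<open>Here the last two exponentials alone reach
      \<open>4 / 5 + 1 / 5\<close>.\<close>
    then have p: "p \<le> (5 / 4)\<^sup>2" unfolding p_def using assms by (intro power_mono) auto
    have "(4 / 5 :: real) \<le> exp (- (11 / 50))"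
      using exp_minus_power_ge[of "11 / 100" 1] by simp
    also have "\<dots> \<le> exp (- (9 / 64 * p))" using p by (simp add: power2_eq_square)
    finally have "4 / 5 \<le> exp (- (9 / 64 * p))" .
    moreover have "(1 / 5 :: real) \<le> exp (- (8 / 5))"
      using exp_minus_power_ge[of "1 / 10" 8] by (simp add: power_divide)
    moreover have "exp (- (8 / 5)) \<le> exp (- p)" using p by (simp add: power2_eq_square)
    ultimately show ?thesis using \<open>0 \<le> A\<close> unfolding defs by linarith
  next
    case 2
    have p: "p \<le> 63 / 20 * b - 19 / 8"
    proof -
      have "(b - 5 / 4) * (19 / 10 - b) \<ge> 0" using 2 by (intro mult_nonneg_nonneg) auto
      then show ?thesis by (simp add: p_def power2_eq_square field_simps)
    qed
    \<comment> \<open>The tangent points \<open>2\<close>, \<open>9 / 25\<close> and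
      \<open>64 / 25\<close> are the three exponents at \<open>a = 1\<close>,
      \<open>b = 8 / 5\<close>.\<close>
    have "27 / 200 \<le> exp (- 2 :: real)"
      using exp_minus_power_ge[of "1 / 20" 20] by (simp add: power_divide)
    from exp_minus_tangent[OF this _ a2]
    have "27 / 200 * (1 + 2 - (162 / 25 - 18 / 5 * b + p / 2)) \<le> A" by (simp add: defs)
    moreover have "697 / 1000 \<le> exp (- (9 / 25) :: real)"
      using exp_minus_power_ge[of "3 / 50" 3] by (simp add: power_divide)
    from exp_minus_tangent[OF this _ order_refl[of "9 / 64 * p"]]
    have "697 / 1000 * (1 + 9 / 25 - 9 / 64 * p) \<le> B" by (simp add: defs)
    moreover have "77 / 1000 \<le> exp (- (64 / 25) :: real)"
      using exp_minus_power_ge[of "1 / 25" 32] by (simp add: power_divide)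
    from exp_minus_tangent[OF this _ order_refl[of "p"]]
    have "77 / 1000 * (1 + 64 / 25 - p) \<le> C" by (simp add: defs)
    ultimately show ?thesis using p 2 by (simp add: field_simps)
  next
    case 3
    have p: "p \<le> 11 / 2 * b - 171 / 25"
    proof -
      have "(b - 19 / 10) * (18 / 5 - b) \<ge> 0" using 3 by (intro mult_nonneg_nonneg) auto
      then show ?thesis by (simp add: p_def power2_eq_square field_simps)
    qed
    \<comment> \<open>The tangent points belong to \<open>a = 3 / 4\<close>,
      \<open>b = 21 / 10\<close>, the second one rounded; \<open>C\<close> is dropped.\<close>
    have "81 / 250 \<le> exp (- (9 / 8) :: real)"
      using exp_minus_power_ge[of "1 / 16" 9] by (simp add: power_divide)
    from exp_minus_tangent[OF this _ a2]
    have "81 / 250 * (1 + 9 / 8 - (162 / 25 - 18 / 5 * b + p / 2)) \<le> A" by (simp add: defs)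
    moreover have "537 / 1000 \<le> exp (- (31 / 50) :: real)"
      using exp_minus_power_ge[of "31 / 500" 5] by (simp add: power_divide)
    from exp_minus_tangent[OF this _ order_refl[of "9 / 64 * p"]]
    have "537 / 1000 * (1 + 31 / 50 - 9 / 64 * p) \<le> B" by (simp add: defs)
    ultimately show ?thesis using p 3 \<open>0 \<le> C\<close> by (simp add: field_simps)
  qed
  then show ?thesis by (simp add: defs p_def)
qed

lemma power_le_exp:
  fixes x :: real and n :: nat
  assumes "0 \<le> x"
  shows "(1 + x + x\<^sup>2 / 2) ^ n \<le> exp (n * x)"
  using power_mono[OF exp_lower_Taylor_quadratic[OF assms], of n] assms
  by (simp add: exp_of_nat_mult)

text \<open>One term on the right suffices. If \<open>a\<close> is large relative to
  \<open>b\<close>, then \<open>b \<le> 10 / 9 * u\<close> and the second term wins; otherwise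
  \<open>a \<le> 4 / 9 * u\<close> and the first one does.\<close>

lemma tail_bound_large_range:
  fixes a b :: real
  assumes "0 \<le> a" "0 \<le> b" "9 / 5 \<le> a + b / 2"
  defines "u \<equiv> a + b / 2"
  shows "32 * exp (- 2 * (u - 1 / 12)\<^sup>2 * (21 / 25)\<^sup>2)
    \<le> 2 * exp (- (2 * a\<^sup>2)) + exp (- (9 / 64 * b\<^sup>2)) + exp (- b\<^sup>2)"
proof -
  define d where "d = u - 9 / 5"
  have d: "0 \<le> d" "u = 9 / 5 + d" using assms by (auto simp: d_def)
  define e where "e = d\<^sup>2"
  have e: "0 \<le> e" by (simp add: e_def)
  have sq: "(u - 1 / 12)\<^sup>2 = e + 103 / 30 * d + (103 / 60)\<^sup>2" "u\<^sup>2 = e + 18 / 5 * d + (9 / 5)\<^sup>2"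
    unfolding d(2) e_def by (simp_all add: power2_eq_square algebra_simps)
  have K: "2 * (u - 1 / 12)\<^sup>2 * (21 / 25)\<^sup>2 = 882 / 625 * (u - 1 / 12)\<^sup>2"
    by (simp add: power_divide)
  have c: "(103 / 60)\<^sup>2 = (10609 / 3600 :: real)" "(9 / 5)\<^sup>2 = (81 / 25 :: real)"
    by (simp_all add: power2_eq_square)
  show ?thesis
  proof (cases "2 / 5 * b \<le> a")
    case True
    then have "b\<^sup>2 \<le> (10 / 9 * u)\<^sup>2" using assms by (intro power_mono) (auto simp: u_def)
    then have "9 / 64 * b\<^sup>2 \<le> 25 / 144 * u\<^sup>2" by (simp add: power_mult_distrib power_divide)
    \<comment> \<open>In terms of \<open>d\<close> and \<open>e\<close> the difference of the two
      sides has nonnegative coefficients. \<open>359 / 100\<close> is the gap at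
      \<open>u = 9 / 5\<close> rounded down, and it exceeds \<open>ln 32\<close>.\<close>
    moreover have "2 * (u - 1 / 12)\<^sup>2 * (21 / 25)\<^sup>2 \<ge> 25 / 144 * u\<^sup>2 + 359 / 100"
      unfolding K unfolding sq c using d(1) e by (simp add: algebra_simps)
    ultimately have le: "9 / 64 * b\<^sup>2 + 359 / 100 \<le> 2 * (u - 1 / 12)\<^sup>2 * (21 / 25)\<^sup>2" by linarith
    have "32 \<le> exp (359 / 100 :: real)"
    proof -
      have "32 \<le> (1 + 359 / 800 + (359 / 800)\<^sup>2 / 2 :: real) ^ 8" by (simp add: power2_eq_square power_divide)
      also have "\<dots> \<le> exp (8 * (359 / 800))" using power_le_exp[of "359 / 800" 8] by simp
      also have "\<dots> \<le> exp (359 / 100)" by simp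
      finally show ?thesis .
    qed
    then have "32 * exp (- 2 * (u - 1 / 12)\<^sup>2 * (21 / 25)\<^sup>2) \<le> exp (359 / 100) * exp (- 2 * (u - 1 / 12)\<^sup>2 * (21 / 25)\<^sup>2)"
      by (intro mult_right_mono) auto
    also have "\<dots> \<le> exp (- (9 / 64 * b\<^sup>2))"
      using le by (simp flip: exp_add)
    finally show ?thesis using exp_ge_zero[of "- (2 * a\<^sup>2)"] exp_ge_zero[of "- b\<^sup>2"] by linarith
  next
    case False
    then have "a\<^sup>2 \<le> (4 / 9 * u)\<^sup>2" using assms by (intro power_mono) (auto simp: u_def)
    then have "2 * a\<^sup>2 \<le> 32 / 81 * u\<^sup>2" by (simp add: power_mult_distrib power_divide)
    \<comment> \<open>Again the gap at \<open>u = 9 / 5\<close> rounded down. It need only exceed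
      \<open>ln 16\<close>, because the first term carries the factor \<open>2\<close>.\<close>
    moreover have "2 * (u - 1 / 12)\<^sup>2 * (21 / 25)\<^sup>2 \<ge> 32 / 81 * u\<^sup>2 + 287 / 100"
      unfolding K unfolding sq c using d(1) e by (simp add: algebra_simps)
    ultimately have le: "2 * a\<^sup>2 + 287 / 100 \<le> 2 * (u - 1 / 12)\<^sup>2 * (21 / 25)\<^sup>2" by linarith
    have "16 \<le> exp (287 / 100 :: real)"
    proof -
      have "16 \<le> (1 + 287 / 800 + (287 / 800)\<^sup>2 / 2 :: real) ^ 8" by (simp add: power2_eq_square power_divide)
      also have "\<dots> \<le> exp (8 * (287 / 800))" using power_le_exp[of "287 / 800" 8] by simp
      also have "\<dots> \<le> exp (287 / 100)" by simp
      finally show ?thesis .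
    qed
    then have "16 * exp (- 2 * (u - 1 / 12)\<^sup>2 * (21 / 25)\<^sup>2) \<le> exp (287 / 100) * exp (- 2 * (u - 1 / 12)\<^sup>2 * (21 / 25)\<^sup>2)"
      by (intro mult_right_mono) auto
    also have "\<dots> \<le> exp (- (2 * a\<^sup>2))"
      using le by (simp flip: exp_add)
    finally show ?thesis using exp_ge_zero[of "- (9 / 64 * b\<^sup>2)"] exp_ge_zero[of "- b\<^sup>2"] by linarith
  qed
qed


section \<open>Deviations on the sphere\<close>

lemma empirical_cdf_scale_sgn:
  fixes z :: "real ^ 'n"
  assumes "z \<noteq> 0" "0 < c"
  shows "empirical_cdf (c *\<^sub>R sgn z) x = empirical_cdf z (x * norm z / c)"
proof -
  have "c * (z $ i / norm z) \<le> x \<longleftrightarrow> z $ i \<le> x * norm z / c" for i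
    using assms by (simp add: field_simps)
  moreover have "(c *\<^sub>R sgn z) $ i = c * (z $ i / norm z)" for i
    by (simp add: sgn_div_norm divide_inverse mult.commute)
  ultimately show ?thesis
    by (simp only: empirical_cdf_def indicator_def atMost_iff)
qed

text \<open>For \<open>s = 1\<close> the level moves towards \<open>0\<close> by at most the ratio
  \<open>r = sqrt ((N - 1) / N)\<close>, so \<open>\<Phi>\<close> grows by at most
  \<open>(1 / r - 1) / 4\<close>, which is at most \<open>1 / (8 * (N - 1))\<close>. For
  \<open>s = -1\<close> the level also moves towards \<open>0\<close>, and the growth of
  \<open>\<Phi>\<close> only helps.\<close>

lemma left_deviation_rescale:
  fixes z :: "real ^ 'n"
  assumes "2 \<le> CARD('n)" "z \<noteq> 0" "s \<in> {1, -1}"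
    and dev: "left_deviation s v (sqrt CARD('n) *\<^sub>R sgn z)"
    and norm: "norm z \<in> (if s = 1 then {sqrt (real CARD('n) - 1)..} else {..sqrt CARD('n)})"
  shows "left_deviation s (v - 1 / (8 * (real CARD('n) - 1))) z"
proof -
  define N where "N = real CARD('n)"
  have N: "2 \<le> N" using assms(1) by (simp add: N_def)
  from dev obtain x where x: "x < 0" "s * (empirical_cdf (sqrt N *\<^sub>R sgn z) x - \<Phi> x) > v"
    by (auto simp: left_deviation_def N_def)
  define y where "y = x * norm z / sqrt N"
  have y: "y < 0"
    using x N \<open>z \<noteq> 0\<close> by (simp add: y_def divide_neg_pos mult_neg_pos)
  have emp: "empirical_cdf (sqrt N *\<^sub>R sgn z) x = empirical_cdf z y"
    unfolding y_def using N \<open>z \<noteq> 0\<close> by (intro empirical_cdf_scale_sgn) auto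
  have "s * \<Phi> y \<le> s * \<Phi> x + 1 / (8 * (N - 1))"
  proof (cases "s = 1")
    case True
    define r where "r = sqrt (N - 1) / sqrt N"
    have r: "0 < r" "r \<le> 1" using N by (auto simp: r_def)
    have "norm z \<ge> sqrt (N - 1)" using norm True by (simp add: N_def)
    then have "r \<le> norm z / sqrt N" using N by (simp add: r_def divide_right_mono)
    then have "y \<le> r * x"
      using x(1) mult_right_mono_neg[of r "norm z / sqrt N" x] by (simp add: y_def mult.commute)
    then have "\<Phi> y \<le> \<Phi> (r * x)" by (rule gauss.cdf_nondecreasing)
    also have "\<dots> \<le> \<Phi> x + (1 / r - 1) / 4" using x r by (intro \<Phi>_scale_le) auto
    also have "1 / r \<le> 1 + 1 / (2 * (N - 1))"
    proof -
      have "1 / r = sqrt (N / (N - 1))" by (simp add: r_def real_sqrt_divide)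
      also have "\<dots> \<le> 1 + 1 / (2 * (N - 1))"
      proof (rule real_le_lsqrt)
        have "N / (N - 1) = 1 + 2 * (1 / (2 * (N - 1)))" using N by (simp add: field_simps)
        also have "\<dots> \<le> (1 + 1 / (2 * (N - 1)))\<^sup>2" by (simp add: power2_sum)
        finally show "N / (N - 1) \<le> (1 + 1 / (2 * (N - 1)))\<^sup>2" .
      qed (use N in auto)
      finally show ?thesis .
    qed
    finally show ?thesis using True N by (simp add: field_simps)
  next
    case False
    then have s: "s = -1" using assms(3) by simp
    have "norm z \<le> sqrt N" using norm s by (simp add: N_def)
    then have "norm z / sqrt N \<le> 1" using N by simp
    then have "x \<le> y"
      using x(1) mult_right_mono_neg[of "norm z / sqrt N" 1 x] by (simp add: y_def mult.commute)
    then have "\<Phi> x \<le> \<Phi> y" by (rule gauss.cdf_nondecreasing)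
    moreover have "0 \<le> 1 / (8 * (N - 1))" using N by simp
    ultimately show ?thesis unfolding s by linarith
  qed
  then have "s * (empirical_cdf z y - \<Phi> y) > v - 1 / (8 * (N - 1))"
    using x(2) unfolding emp by (simp add: right_diff_distrib)
  then show ?thesis
    using y unfolding left_deviation_def N_def by blast
qed

lemma sphere_left_deviation_le:
  fixes s v :: real
  assumes "2 \<le> CARD('n)" "s \<in> {1, -1}" and v: "1 / (8 * (real CARD('n) - 1)) < v"
  shows "measure uniform_sphere {w :: real ^ 'n. left_deviation s v (sqrt CARD('n) *\<^sub>R w)}
    \<le> 8 * exp (- 2 * CARD('n) * (v - 1 / (8 * (real CARD('n) - 1)))\<^sup>2 * (21 / 25)\<^sup>2)"
proof -
  interpret G: prob_space "gauss_measure :: (real ^ 'n) measure" by (rule prob_space_gauss_measure)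
  define l where "l = 1 / (8 * (real CARD('n) - 1))"
  define A where "A = {w :: real ^ 'n. left_deviation s v (sqrt CARD('n) *\<^sub>R w)}"
  define B where "B = (if s = 1 then {sqrt (real CARD('n) - 1)..} else {..sqrt CARD('n)})"
  have [measurable]: "A \<in> sets borel"
    unfolding A_def by measurable
  have [measurable]: "B \<in> sets borel"
    unfolding B_def by (intro borel_closed) simp
  have "1 / 2 \<le> measure gauss_measure {z :: real ^ 'n. norm z \<in> B}"
    using gauss_norm_ge_sqrt[OF assms(1)] gauss_norm_le_sqrt[where 'n='n] by (simp add: B_def)
  \<comment> \<open>Independence of direction and norm: conditioning on
    \<open>norm z \<in> B\<close> costs the factor two that turns \<open>4\<close> into
    \<open>8\<close>.\<close>
  then have "measure uniform_sphere A * (1 / 2) \<le> measure uniform_sphere A * measure gauss_measure {z :: real ^ 'n. norm z \<in> B}"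
    by (intro mult_left_mono) auto
  also have "\<dots> = measure gauss_measure {z. sgn z \<in> A \<and> norm z \<in> B}"
    by (rule gauss_direction_norm_indep[symmetric]) measurable
  also have "\<dots> \<le> measure gauss_measure {z :: real ^ 'n. left_deviation s (v - l) z}"
  proof (rule G.finite_measure_mono_AE)
    show "AE z in gauss_measure. z \<in> {z. sgn z \<in> A \<and> norm z \<in> B} \<longrightarrow> z \<in> {z :: real ^ 'n. left_deviation s (v - l) z}"
      using AE_gauss_measure_nonzero
    proof eventually_elim
      case (elim z)
      then show ?case
        using left_deviation_rescale[OF assms(1) elim assms(2), of v] by (auto simp: A_def B_def l_def)
    qed
  qed measurable
  also have "\<dots> \<le> 4 * exp (- 2 * CARD('n) * (v - l)\<^sup>2 * (21 / 25)\<^sup>2)"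
    using v assms(2) by (intro gauss_left_deviation_le) (auto simp: l_def)
  finally show ?thesis by (simp add: A_def l_def)
qed

section \<open>From the Kolmogorov-Smirnov distance to left deviations\<close>

lemma empirical_cdf_bounds:
  fixes z :: "real ^ 'n"
  shows "0 \<le> empirical_cdf z x" "empirical_cdf z x \<le> 1"
proof -
  have "(\<Sum>i\<in>UNIV. indicator {..x} (z $ i)) \<le> (\<Sum>i\<in>(UNIV :: 'n set). 1 :: real)"
    by (intro sum_mono) (auto simp: indicator_def)
  then show "empirical_cdf z x \<le> 1" by (simp add: empirical_cdf_def field_simps)
qed (simp add: empirical_cdf_def sum_nonneg)

lemma empirical_deviation_le_1:
  fixes z :: "real ^ 'n"
  shows "\<bar>empirical_cdf z x - \<Phi> x\<bar> \<le> 1"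
  using empirical_cdf_bounds[of z x] gauss.cdf_nonneg[of x] gauss.cdf_bounded_prob[of x] by auto

lemma ks_dist_empirical_le_1: "ks_dist (empirical_cdf z) \<Phi> \<le> 1"
  unfolding ks_dist_def by (intro cSUP_least empirical_deviation_le_1) simp

text \<open>Reflection turns \<open>{..x}\<close> into the complement of \<open>{..<- x}\<close>, so
  \<open>T\<close> is the left limit at \<open>- x\<close> of the empirical distribution function of
  \<open>- z\<close>. For \<open>s = 1\<close> it is reached from slightly further left, by
  continuity of \<open>\<Phi>\<close>; for \<open>s = -1\<close> the value at \<open>- x\<close> is
  even larger than or equal to \<open>T\<close>.\<close>

lemma left_deviation_minus_if_right_deviation:
  fixes z :: "real ^ 'n"
  assumes "s \<in> {1, -1}" "0 < x" and dev: "s * (empirical_cdf z x - \<Phi> x) > v"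
  shows "left_deviation (- s) v (- z)"
proof -
  define T where "T = (\<Sum>i\<in>UNIV. indicator {..<- x} (- z $ i) :: real) / CARD('n)"
  have "(\<Sum>i\<in>UNIV. indicator {..x} (z $ i) :: real) = (\<Sum>i\<in>UNIV. 1 - indicator {..<- x} (- z $ i))"
    by (intro sum.cong) (auto simp: indicator_def)
  then have emp: "empirical_cdf z x = 1 - T"
    by (simp add: empirical_cdf_def T_def sum_subtractf field_simps)
  have dev': "- s * (T - \<Phi> (- x)) > v"
    using dev by (simp add: emp \<Phi>_minus algebra_simps)
  show ?thesis
  proof (cases "s = 1")
    case True
    have "(\<Phi> \<longlongrightarrow> \<Phi> (- x)) (at_left (- x))"
      using isCont_\<Phi>[of "- x", unfolded isCont_def filterlim_at_split] by simp
    moreover have "v + T < \<Phi> (- x)" using dev' True by simp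
    ultimately have "eventually (\<lambda>y. v + T < \<Phi> y) (at_left (- x))"
      by (rule order_tendstoD)
    then obtain b where b: "b < - x" "\<And>y. b < y \<Longrightarrow> y < - x \<Longrightarrow> v + T < \<Phi> y"
      by (auto simp: eventually_at_left_field)
    obtain y where y: "b < y" "y < - x" using dense[OF b(1)] by auto
    have "empirical_cdf (- z) y \<le> T"
      unfolding empirical_cdf_def T_def using y
      by (simp, intro divide_right_mono sum_mono) (auto simp: indicator_def)
    with b(2)[OF y] y True \<open>0 < x\<close> show ?thesis
      unfolding left_deviation_def by (intro exI[of _ y]) auto
  next
    case False
    then have s: "s = -1" using assms(1) by simp
    have "T \<le> empirical_cdf (- z) (- x)"
      unfolding empirical_cdf_def T_def
      by (simp, intro divide_right_mono sum_mono) (auto simp: indicator_def)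
    with dev' s \<open>0 < x\<close> show ?thesis
      unfolding left_deviation_def by (intro exI[of _ "- x"]) auto
  qed
qed

lemma left_deviation_if_ks_dist_gt:
  fixes z :: "real ^ 'n"
  assumes "v < ks_dist (empirical_cdf z) \<Phi>"
  shows "\<exists>s\<in>{1, -1}. left_deviation s v z \<or> left_deviation s v (- z)"
proof -
  have "\<exists>x. v < \<bar>empirical_cdf z x - \<Phi> x\<bar>"
    using assms unfolding ks_dist_def
    by (subst (asm) less_cSUP_iff) (auto intro!: bdd_aboveI2 empirical_deviation_le_1)
  then obtain x where "v < \<bar>empirical_cdf z x - \<Phi> x\<bar>" ..
  then obtain s :: real where s: "s \<in> {1, -1}" "s * (empirical_cdf z x - \<Phi> x) > v"
    by (metis abs_if insertI1 insertI2 mult_1 mult_minus1)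
  show ?thesis
  proof (cases "x < 0")
    case True
    with s show ?thesis by (auto simp: left_deviation_def)
  next
    case False
    \<comment> \<open>Reflection needs a strictly positive level; right continuity provides one even
      from \<open>x = 0\<close>.\<close>
    have "eventually (\<lambda>y. s * (empirical_cdf z y - \<Phi> y) > v) (at_right x)"
      using empirical_deviation_right_continuous s(2) by (rule order_tendstoD)
    then obtain b where b: "b > x" "\<And>y. x < y \<Longrightarrow> y < b \<Longrightarrow> s * (empirical_cdf z y - \<Phi> y) > v"
      by (auto simp: eventually_at_right_field)
    obtain y where "x < y" "y < b" using dense[OF b(1)] by auto
    with b(2) False have "left_deviation (- s) v (- z)"
      by (intro left_deviation_minus_if_right_deviation[OF s(1), of y]) auto
    then show ?thesis using s(1) by auto
  qed
qed

text \<open>Two signs and two half lines give four events of probability at most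
  \<open>8 * exp ...\<close> each; the right half line is covered by invariance of
  \<open>uniform_sphere\<close> under \<open>uminus\<close>.\<close>

lemma sphere_ks_dist_le:
  fixes v :: real
  assumes "2 \<le> CARD('n)" and v: "1 / (8 * (real CARD('n) - 1)) < v"
  defines "N \<equiv> real CARD('n)"
  shows "measure uniform_sphere {w :: real ^ 'n. \<exists>s\<in>{1, -1}.
      left_deviation s v (sqrt N *\<^sub>R w) \<or> left_deviation s v (- (sqrt N *\<^sub>R w))}
    \<le> 32 * exp (- 2 * N * (v - 1 / (8 * (N - 1)))\<^sup>2 * (21 / 25)\<^sup>2)"
proof -
  interpret S: prob_space "uniform_sphere :: (real ^ 'n) measure" by (rule prob_space_uniform_sphere)
  define L where "L s c = {w :: real ^ 'n. left_deviation s v (sqrt N *\<^sub>R (c *\<^sub>R w))}" for s c :: real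
  define C where "C = 8 * exp (- 2 * N * (v - 1 / (8 * (N - 1)))\<^sup>2 * (21 / 25)\<^sup>2)"
  have [measurable]: "L s c \<in> sets borel" for s c
    unfolding L_def by measurable
  have L1: "measure uniform_sphere (L s 1) \<le> C" if "s \<in> {1, -1}" for s
    using sphere_left_deviation_le[OF assms(1) that v] by (simp add: L_def C_def N_def)
  have neg: "distr uniform_sphere borel uminus = (uniform_sphere :: (real ^ 'n) measure)"
    by (rule distr_uniform_sphere_orthogonal)
       (auto simp: orthogonal_transformation_def linear_iff)
  have Lm1: "measure uniform_sphere (L s (- 1)) \<le> C" if "s \<in> {1, -1}" for s
  proof -
    have "measure uniform_sphere (L s 1) = measure (distr uniform_sphere borel uminus) (L s 1)"
      by (simp only: neg)
    also have "\<dots> = measure uniform_sphere (L s (- 1))"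
      by (subst measure_distr) (auto simp: L_def uniform_sphere_def intro!: arg_cong2[where f=measure])
    finally show ?thesis using L1[OF that] by simp
  qed
  have "{w :: real ^ 'n. \<exists>s\<in>{1, -1}. left_deviation s v (sqrt N *\<^sub>R w) \<or> left_deviation s v (- (sqrt N *\<^sub>R w))}
      = (L 1 1 \<union> L 1 (- 1)) \<union> (L (- 1) 1 \<union> L (- 1) (- 1))"
    by (auto simp: L_def)
  also have "measure uniform_sphere \<dots> \<le> (C + C) + (C + C)"
    by (intro order_trans[OF measure_Un_le] add_mono L1 Lm1) auto
  finally show ?thesis by (simp add: C_def)
qed

theorem corollary2p2:
  fixes M :: "'a measure" and X :: "'a \<Rightarrow> real ^ 'n" and \<epsilon> t :: real
  defines "N \<equiv> real CARD('n)"
  assumes "prob_space M"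
    and "X \<in> borel_measurable M"
    and "distr M borel X = uniform_sphere"
    and "\<epsilon> > 0" and "0 \<le> t" and "t < 1"
  shows "measure M {\<omega> \<in> space M.
             ks_dist (empirical_cdf (sqrt N *\<^sub>R X \<omega>)) (cdf std_normal_distribution) > \<epsilon> + t / 2}
         \<le> 2 * exp (- 2 * N * \<epsilon>\<^sup>2) + exp (- (9 / 64) * N * t\<^sup>2) + exp (- N * t\<^sup>2)"
    (is "measure M ?D \<le> ?R")
proof -
  interpret prob_space M by fact
  note [measurable] = \<open>X \<in> borel_measurable M\<close>
  define a b u where "a = sqrt N * \<epsilon>" and "b = sqrt N * t" and "u = a + b / 2"
  define v where "v = \<epsilon> + t / 2"
  have N: "0 < N" by (simp add: N_def)
  have ab: "0 \<le> a" "0 \<le> b" using assms(5,6) N by (auto simp: a_def b_def)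
  have R: "?R = 2 * exp (- (2 * a\<^sup>2)) + exp (- (9 / 64 * b\<^sup>2)) + exp (- b\<^sup>2)"
    using N by (simp add: a_def b_def power_mult_distrib mult.assoc)
  have u: "u = sqrt N * v" by (simp add: u_def a_def b_def v_def algebra_simps)
  \<comment> \<open>The distance never exceeds \<open>1\<close>, which settles the first case; in
    the second the claimed bound is at least \<open>1\<close>.\<close>
  consider "1 \<le> v" | "u \<le> 9 / 5" | "v < 1" "9 / 5 \<le> u" by linarith
  then show ?thesis
  proof cases
    case 1
    have "\<not> ks_dist (empirical_cdf (sqrt N *\<^sub>R X \<omega>)) \<Phi> > \<epsilon> + t / 2" for \<omega>
      using ks_dist_empirical_le_1[of "sqrt N *\<^sub>R X \<omega>"] 1 unfolding v_def by linarith
    then have D: "?D = {}" by auto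
    show ?thesis unfolding D by simp
  next
    case 2
    have "measure M ?D \<le> 1" by (rule prob_le_1)
    also have "1 \<le> ?R" unfolding R using tail_bound_trivial_range[OF ab] 2 by (simp add: u_def)
    finally show ?thesis .
  next
    case 3
    define l where "l = 1 / (8 * (N - 1))"
    \<comment> \<open>\<open>v < 1\<close> and \<open>u \<ge> 9 / 5\<close> force
      \<open>N > 81 / 25\<close>, hence \<open>N \<ge> 4\<close>.\<close>
    have "sqrt N * v < sqrt N * 1" using 3 N by (intro mult_strict_left_mono) auto
    then have "9 / 5 < sqrt N" using 3 unfolding u by linarith
    then have "(9 / 5)\<^sup>2 < N"
      using power_strict_mono[of "9 / 5" "sqrt N" 2] N by simp
    then have "3 < CARD('n)" by (simp add: N_def power2_eq_square)
    then have card: "4 \<le> CARD('n)" and N4: "4 \<le> N" by (simp_all add: N_def)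
    \<comment> \<open>The rescaling loss in units of \<open>1 / sqrt N\<close> is largest at
      \<open>N = 4\<close>, where it equals \<open>1 / 12\<close>.\<close>
    have l: "sqrt N * l \<le> 1 / 12"
    proof -
      define q where "q = sqrt N"
      have q: "2 \<le> q" "q\<^sup>2 = N" using N4 real_le_rsqrt[of 2 N] by (auto simp: q_def)
      have "0 \<le> (2 * q + 1) * (q - 2)" using q by simp
      then have "12 * q \<le> 8 * (N - 1)"
        unfolding q(2)[symmetric] by (simp add: power2_eq_square algebra_simps)
      then show ?thesis using N4 by (simp add: l_def q_def field_simps)
    qed
    have lv: "l < v"
    proof -
      have "sqrt N * l < sqrt N * v" using l 3 by (simp add: u)
      then show ?thesis using N by simp
    qed
    define E where "E = {w :: real ^ 'n. \<exists>s\<in>{1, -1}.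
      left_deviation s v (sqrt N *\<^sub>R w) \<or> left_deviation s v (- (sqrt N *\<^sub>R w))}"
    have [measurable]: "E \<in> sets borel" unfolding E_def by measurable
    \<comment> \<open>The supremum event is enclosed in the measurable event \<open>E\<close>, whose
      probability depends only on the law of \<open>X\<close>.\<close>
    have "?D \<subseteq> X -` E \<inter> space M"
      using left_deviation_if_ks_dist_gt by (auto simp: E_def v_def)
    then have "measure M ?D \<le> measure M (X -` E \<inter> space M)"
      by (intro finite_measure_mono) measurable
    also have "\<dots> = measure uniform_sphere E"
      unfolding assms(4)[symmetric] by (subst measure_distr) auto
    also have "\<dots> \<le> 32 * exp (- 2 * N * (v - l)\<^sup>2 * (21 / 25)\<^sup>2)"
      using sphere_ks_dist_le[of v, where 'n='n] card lv unfolding E_def l_def N_def by simp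
    also have "\<dots> \<le> 32 * exp (- 2 * (u - 1 / 12)\<^sup>2 * (21 / 25)\<^sup>2)"
    proof -
      have "(u - 1 / 12)\<^sup>2 \<le> (sqrt N * (v - l))\<^sup>2"
        using l 3 by (intro power_mono) (simp_all add: u right_diff_distrib)
      then have "(u - 1 / 12)\<^sup>2 \<le> N * (v - l)\<^sup>2"
        using N by (simp add: power_mult_distrib)
      then show ?thesis by simp
    qed
    also have "\<dots> \<le> ?R"
      unfolding R u_def using ab 3 by (intro tail_bound_large_range) (simp_all add: u_def)
    finally show ?thesis .
  qed
qed

end
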